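(* Let $X$ be a separable Banach space, $I=[a,b)$ a real interval, $s>0$ and $0<p,q\le\infty$. (i) Let $0<\varepsilon<s$, $0<\nu\le\infty$, and $q\le\theta\le\infty$. Then \[ B^s_{p,q}(I,X)\hookrightarrow B^{s-\varepsilon}_{p,\nu}(I,X)\qquad\text{and}\qquad B^s_{p,q}(I,X)\hookrightarrow B^s_{p,\theta}(I,X). \] (ii) If the interval $I$ is bounded, then for $0<\tau\le p$ we have the embedding \[ B^s_{p,q}(I,X)\hookrightarrow B^s_{\tau,q}(I,X). \]
   Context: $\hookrightarrow$ denotes continuous embedding. $|I|$ is the length of $I$. $L_p(I,X)$ is the space of measurable $f:I\to X$ with $\|f\|_{L_p(I,X)}=(\int_I\|f(t)\|_X^p\,dt)^{1/p}<\infty$ (ess sup if $p=\infty$). For $k\in\mathbb{N}$, $h>0$, $\Delta_h^kf(t)=\sum_{i=0}^k\binom ki(-1)^{k-i}f(t+ih)$ for $t\in I_{kh}=\{t\in I:t+kh\in I\}$, and $\omega_k(f,I,u)_p=\sup_{0<h\le u}\|\Delta_h^kf\|_{L_p(I_{kh},X)}$. For $s>0$, $0<p,q\le\infty$, $B^s_{p,q}(I,X)$ is the set of $f\in L_p(I,X)$ such that, with $k=\lfloor s\rfloor+1$, $|f|_{B^s_{p,q}(I,X)}=\big(\int_0^{|I|/k}[u^{-s}\omega_k(f,I,u)_p]^q\frac{du}u\big)^{1/q}<\infty$ (for $q=\infty$: $\sup_{0<u<|I|/k}u^{-s}\omega_k(f,I,u)_p$), with quasi-norm $\|f\|_{B^s_{p,q}(I,X)}=\|f\|_{L_p(I,X)}+|f|_{B^s_{p,q}(I,X)}$.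 *)

theory Defs
  imports "HOL-Probability.Probability"
begin

text \<open>Functions \<open>f : I \<rightarrow> X\<close> are represented by total functions on the reals; everything
  below depends only on their values on \<open>I\<close>. (Quasi-)norms take values in
  \<^typ>\<open>ennreal\<close>, so they make sense, with value \<open>\<infinity>\<close>, outside the corresponding space, and
  integrals are Lebesgue integrals of nonnegative functions.\<close>

text \<open>Only used for exponents \<open>r > 0\<close>.\<close>

definition ennreal_powr :: "ennreal \<Rightarrow> real \<Rightarrow> ennreal" where
  "ennreal_powr x r = (if x = \<infinity> then \<infinity> else ennreal (enn2real x powr r))"

definition lp_qnorm :: "ennreal \<Rightarrow> real set \<Rightarrow> (real \<Rightarrow> 'x::real_normed_vector) \<Rightarrow> ennreal" where
  "lp_qnorm p I f =
     (if p = \<infinity> then esssup (lebesgue_on I) (\<lambda>t. ennreal (norm (f t)))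
      else ennreal_powr (\<integral>\<^sup>+t. ennreal_powr (ennreal (norm (f t))) (enn2real p) \<partial>lebesgue_on I)
             (1 / enn2real p))"

definition lp_set :: "ennreal \<Rightarrow> real set \<Rightarrow> (real \<Rightarrow> 'x::real_normed_vector) set" where
  "lp_set p I = {f \<in> borel_measurable (lebesgue_on I). lp_qnorm p I f < \<infinity>}"

definition fin_diff :: "nat \<Rightarrow> real \<Rightarrow> (real \<Rightarrow> 'x::real_vector) \<Rightarrow> real \<Rightarrow> 'x" where
  "fin_diff k h f t = (\<Sum>i=0..k. (real (k choose i) * (-1) ^ (k - i)) *\<^sub>R f (t + real i * h))"

definition diff_dom :: "real set \<Rightarrow> real \<Rightarrow> real set" where
  "diff_dom I d = {t \<in> I. t + d \<in> I}"

definition modulus_smoothness ::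
    "nat \<Rightarrow> (real \<Rightarrow> 'x::real_normed_vector) \<Rightarrow> real set \<Rightarrow> real \<Rightarrow> ennreal \<Rightarrow> ennreal" where
  "modulus_smoothness k f I u p =
     (SUP h\<in>{0<..u}. lp_qnorm p (diff_dom I (real k * h)) (fin_diff k h f))"

text \<open>The length \<open>|I|\<close>, which is \<open>\<infinity>\<close> for unbounded intervals, is the Lebesgue measure of \<open>I\<close>.\<close>

definition besov_seminorm ::
    "real \<Rightarrow> ennreal \<Rightarrow> ennreal \<Rightarrow> real set \<Rightarrow> (real \<Rightarrow> 'x::real_normed_vector) \<Rightarrow> ennreal" where
  "besov_seminorm s p q I f =
     (let k = nat \<lfloor>s\<rfloor> + 1;
          U = {u. 0 < u \<and> ennreal u < emeasure lebesgue I / of_nat k};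
          g = (\<lambda>u. ennreal (u powr - s) * modulus_smoothness k f I u p)
      in if q = \<infinity> then (SUP u\<in>U. g u)
         else ennreal_powr
                (\<integral>\<^sup>+u. ennreal_powr (g u) (enn2real q) / ennreal u \<partial>lebesgue_on U)
                (1 / enn2real q))"

type_synonym 'f qnormed = "'f set \<times> ('f \<Rightarrow> ennreal)"

definition besov :: "real \<Rightarrow> ennreal \<Rightarrow> ennreal \<Rightarrow> real set \<Rightarrow>
    (real \<Rightarrow> 'x::real_normed_vector) qnormed" where
  "besov s p q I =
     ({f \<in> lp_set p I. besov_seminorm s p q I f < \<infinity>},
      \<lambda>f. lp_qnorm p I f + besov_seminorm s p q I f)"

text \<open>Continuity of the linear inclusion map is expressed, as usual for quasi-normed
  function spaces, by a quasi-norm estimate with a constant independent of \<open>f\<close>.\<close>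

definition cont_embedded :: "'f qnormed \<Rightarrow> 'f qnormed \<Rightarrow> bool" (infix "\<hookrightarrow>" 50) where
  "E \<hookrightarrow> F \<longleftrightarrow> fst E \<subseteq> fst F \<and>
     (\<exists>C::real. 0 \<le> C \<and> (\<forall>f\<in>fst E. snd F f \<le> ennreal C * snd E f))"

end

theory Submission
  imports Defs "HOL-Computational_Algebra.Polynomial"
begin

text \<open>A finite Besov seminorm with parameter \<open>q\<close> gives \<open>\<omega>\<^sub>k(f, u)\<^sub>p \<le> C u\<^sup>s \<parallel>f\<parallel>\<close>, by monotonicity of the
  modulus on \<open>[u, 2u]\<close>; interpolating between this bound and the parameter \<open>q\<close> yields
  every \<open>\<theta> \<ge> q\<close>. To lower the smoothness to \<open>s - \<epsilon>\<close> one may also have to lower the order of the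
  differences, which is done by a Marchaud-type inequality
  \<open>\<omega>\<^sub>j(u) \<le> K N\<^sup>-\<^sup>j \<omega>\<^sub>j(N u) + D \<omega>\<^sub>j\<^sub>+\<^sub>1(u)\<close>: it transfers the decay \<open>u\<^sup>\<sigma>\<close>, for any \<open>\<sigma> < j\<close>,
  from \<open>\<omega>\<^sub>j\<^sub>+\<^sub>1\<close> to \<open>\<omega>\<^sub>j\<close>. With \<open>s - \<epsilon> < \<sigma> < s\<close> the integral near \<open>0\<close> converges for
  every \<open>\<nu>\<close>, and for large \<open>u\<close> one uses \<open>\<omega>\<^sub>j(u) \<le> C \<parallel>f\<parallel>\<^sub>p\<close>. On a bounded interval, \<open>L\<^sub>p\<close> embeds in
  \<open>L\<^sub>\<tau>\<close>, uniformly in the domains of the differences.\<close>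

section \<open>Quasi-norms of nonnegative functions\<close>

text \<open>Every estimate is proved for all functions measurable on \<open>I\<close>, with values
  in \<open>ennreal\<close> that may be infinite and with constants fixed before the function;
  membership in the target space then follows from finiteness of the norms. Two obstacles shape the
  Marchaud step. For \<open>p < 1\<close> each use of the quasi-triangle inequality costs a factor,
  so telescoping over dyadic scales would accumulate constants; instead, one jump by a large factor
  \<open>N\<close> is made whose contribution is damped by more than \<open>1 / 2\<close>, and this
  jump is iterated until a fixed scale is reached where the trivial bound applies. No supremum has
  to be known finite in advance. Moreover, the points of a coarse difference around a given point of
  \<open>I\<close> may leave \<open>I\<close> at either end, so two differently placed expansions
  are combined. The exponent \<sigma> can be chosen because \<open>s - \<epsilon>\<close> lies
  strictly below both \<open>s\<close> and the order of differences that belongs to it.\<close>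

lemma ennreal_powr_mono: "0 \<le> r \<Longrightarrow> x \<le> y \<Longrightarrow> ennreal_powr x r \<le> ennreal_powr y r"
  unfolding ennreal_powr_def
  by (auto simp: top_unique less_top intro!: ennreal_leI powr_mono2 enn2real_mono)

lemma ennreal_powr_ennreal: "0 \<le> x \<Longrightarrow> ennreal_powr (ennreal x) r = ennreal (x powr r)"
  unfolding ennreal_powr_def by simp

lemma ennreal_powr_zero [simp]: "ennreal_powr 0 r = 0"
  unfolding ennreal_powr_def by simp

lemma ennreal_powr_top [simp]: "ennreal_powr top r = top"
  unfolding ennreal_powr_def by simp

lemma ennreal_powr_less_top: "x < top \<Longrightarrow> ennreal_powr x r < top"
  unfolding ennreal_powr_def by auto

lemma ennreal_powr_mult: "ennreal_powr (x * y) r = ennreal_powr x r * ennreal_powr y r"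
proof (cases "x = 0 \<or> y = 0")
  case False
  then show ?thesis
    by (cases x; cases y)
      (auto simp: ennreal_powr_ennreal ennreal_mult[symmetric] ennreal_mult_top ennreal_top_mult powr_mult)
qed auto

lemma ennreal_powr_powr_inverse: "r \<noteq> 0 \<Longrightarrow> ennreal_powr (ennreal_powr x r) (1 / r) = x"
  by (cases x) (auto simp: ennreal_powr_ennreal powr_powr)

lemma ennreal_powr_inverse_powr: "r \<noteq> 0 \<Longrightarrow> ennreal_powr (ennreal_powr x (1 / r)) r = x"
  by (cases x) (auto simp: ennreal_powr_ennreal powr_powr)

lemma ennreal_powr_exponent_add: "ennreal_powr x (r + r') = ennreal_powr x r * ennreal_powr x r'"
  by (cases x) (auto simp: ennreal_powr_ennreal powr_add ennreal_mult)

text \<open>Bounding the sum by twice the maximum is crude, but it treats \<open>r < 1\<close> and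
  \<open>r \<ge> 1\<close> alike.\<close>

lemma ennreal_powr_add:
  assumes "0 < r"
  shows "ennreal_powr (x + y) r \<le> ennreal (2 powr r) * (ennreal_powr x r + ennreal_powr y r)"
proof -
  have "ennreal_powr (x + y) r \<le> ennreal_powr (2 * max x y) r"
    using assms add_mono[of x "max x y" y "max x y"]
    by (intro ennreal_powr_mono) (auto simp: mult_2)
  also have "\<dots> = ennreal (2 powr r) * ennreal_powr (max x y) r"
    using ennreal_powr_ennreal[of 2 r] by (simp add: ennreal_powr_mult)
  also have "ennreal_powr (max x y) r \<le> ennreal_powr x r + ennreal_powr y r"
    by (cases "x \<le> y") (auto simp: max_def add_increasing add_increasing2)
  finally show ?thesis
    by (simp add: mult_left_mono)
qed

lemma ennreal_powr_measurable [measurable]: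
  assumes [measurable]: "g \<in> borel_measurable M"
  shows "(\<lambda>t. ennreal_powr (g t) r) \<in> borel_measurable M"
proof -
  have "g -` {\<infinity>} \<inter> space M \<in> sets M"
    by measurable
  moreover have "g -` {\<infinity>} \<inter> space M = {t \<in> space M. g t = \<infinity>}"
    by auto
  ultimately show ?thesis
    unfolding ennreal_powr_def by (intro measurable_If) simp_all
qed

lemma enn2real_pos: "0 < p \<Longrightarrow> p \<noteq> \<infinity> \<Longrightarrow> 0 < enn2real p"
  by (simp add: enn2real_positive_iff less_top)

section \<open>Translation-invariant quasi-norms on the whole line\<close>

lemma lebesgue_translation_measurable [measurable]: "(\<lambda>t::real. t + c) \<in> lebesgue \<rightarrow>\<^sub>M lebesgue"
  using lebesgue_affine_measurable[of "\<lambda>_::real. 1" c] by (simp add: add.commute)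

lemma lebesgue_translation_distr: "distr lebesgue lebesgue (\<lambda>t::real. t + c) = lebesgue"
  using lebesgue_real_affine[of 1 c] by (simp add: density_1 add.commute)

text \<open>A version of \<^const>\<open>lp_qnorm\<close> for nonnegative functions on the whole line, where, unlike on \<open>I\<close>,
  translation is an isometry; functions on \<open>I\<close> are extended by \<open>0\<close>.\<close>

definition lp_gauge :: "ennreal \<Rightarrow> (real \<Rightarrow> ennreal) \<Rightarrow> ennreal" where
  "lp_gauge p g =
     (if p = \<infinity> then esssup lebesgue g
      else ennreal_powr (\<integral>\<^sup>+t. ennreal_powr (g t) (enn2real p) \<partial>lebesgue) (1 / enn2real p))"

lemma lp_gauge_mono:
  assumes "0 < p" "f \<in> borel_measurable lebesgue" "\<And>t. f t \<le> g t"
  shows "lp_gauge p f \<le> lp_gauge p g"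
  unfolding lp_gauge_def using assms
  by (auto intro!: esssup_mono ennreal_powr_mono nn_integral_mono)

lemma lp_gauge_zero: "0 < p \<Longrightarrow> lp_gauge p (\<lambda>_. 0) = 0"
proof -
  have "esssup lebesgue (\<lambda>_::real. 0::ennreal) \<le> 0"
    by (intro esssup_I) auto
  then show ?thesis
    by (simp add: lp_gauge_def)
qed

lemma lp_gauge_cmult:
  assumes "0 < p" "0 \<le> c" and [measurable]: "g \<in> borel_measurable lebesgue"
  shows "lp_gauge p (\<lambda>t. ennreal c * g t) \<le> ennreal c * lp_gauge p g"
proof (cases "p = \<infinity>")
  case True
  have "AE t in lebesgue. ennreal c * g t \<le> ennreal c * esssup lebesgue g"
    using esssup_AE[of g lebesgue] by eventually_elim (simp add: mult_left_mono)
  then show ?thesis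
    using True by (auto simp: lp_gauge_def intro!: esssup_I)
next
  case False
  then show ?thesis
    using enn2real_pos[OF \<open>0 < p\<close> False]
    by (simp add: lp_gauge_def ennreal_powr_mult nn_integral_cmult ennreal_powr_powr_inverse)
qed

text \<open>The factor \<open>2\<close> is the \<open>1 / P\<close>-th power of the loss
  \<open>2 powr P\<close> under the integral, where \<open>P\<close> is the real exponent;
  \<open>2 powr (1 / P)\<close> is lost when the outer power is applied to a sum of two integrals.
  Both come from \<open>ennreal_powr_add\<close>.\<close>

definition lp_const :: "ennreal \<Rightarrow> real" where
  "lp_const p = (if p = \<infinity> then 1 else 2 * 2 powr (1 / enn2real p))"

lemma lp_const_ge_1: "1 \<le> lp_const p"
proof -
  have "1 * 1 \<le> 2 * 2 powr (1 / enn2real p)"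
    by (intro mult_mono ge_one_powr_ge_zero) auto
  then show ?thesis
    by (simp add: lp_const_def)
qed

lemma lp_gauge_add:
  assumes "0 < p" and [measurable]: "f \<in> borel_measurable lebesgue" "g \<in> borel_measurable lebesgue"
  shows "lp_gauge p (\<lambda>t. f t + g t) \<le> ennreal (lp_const p) * (lp_gauge p f + lp_gauge p g)"
proof (cases "p = \<infinity>")
  case True
  have "AE t in lebesgue. f t + g t \<le> esssup lebesgue f + esssup lebesgue g"
    using esssup_AE[of g lebesgue] esssup_AE[of f lebesgue] by eventually_elim (simp add: add_mono)
  then show ?thesis
    using True by (auto simp: lp_gauge_def lp_const_def intro!: esssup_I)
next
  case False
  define P where "P = enn2real p"
  have P: "0 < P"
    using enn2real_pos[OF \<open>0 < p\<close> False] by (simp add: P_def)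
  let ?F = "\<integral>\<^sup>+t. ennreal_powr (f t) P \<partial>lebesgue" and ?G = "\<integral>\<^sup>+t. ennreal_powr (g t) P \<partial>lebesgue"
  have "(\<integral>\<^sup>+t. ennreal_powr (f t + g t) P \<partial>lebesgue)
      \<le> (\<integral>\<^sup>+t. ennreal (2 powr P) * (ennreal_powr (f t) P + ennreal_powr (g t) P) \<partial>lebesgue)"
    by (intro nn_integral_mono ennreal_powr_add P)
  also have "\<dots> = ennreal (2 powr P) * (?F + ?G)"
    by (simp add: nn_integral_cmult nn_integral_add)
  finally have "lp_gauge p (\<lambda>t. f t + g t) \<le> ennreal_powr (ennreal (2 powr P) * (?F + ?G)) (1 / P)"
    using P False by (auto simp: lp_gauge_def P_def[symmetric] intro!: ennreal_powr_mono)
  also have "\<dots> = ennreal 2 * ennreal_powr (?F + ?G) (1 / P)"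
    using P by (simp add: ennreal_powr_mult ennreal_powr_ennreal powr_powr)
  also have "\<dots> \<le> ennreal 2 * (ennreal (2 powr (1 / P)) * (lp_gauge p f + lp_gauge p g))"
    using P False ennreal_powr_add[of "1 / P" ?F ?G]
    by (intro mult_left_mono) (auto simp: lp_gauge_def P_def[symmetric])
  finally show ?thesis
    using False by (simp add: lp_const_def P_def[symmetric] ennreal_mult mult.assoc)
qed

text \<open>Each summand split off costs one more factor, so the constant grows with the number of
  summands.\<close>

lemma lp_gauge_sum:
  assumes "0 < p" "finite A" "\<And>i. i \<in> A \<Longrightarrow> g i \<in> borel_measurable lebesgue"
  shows "lp_gauge p (\<lambda>t. \<Sum>i\<in>A. g i t) \<le> ennreal (lp_const p ^ card A) * (\<Sum>i\<in>A. lp_gauge p (g i))"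
  using assms(2,3)
proof (induction A)
  case empty
  then show ?case using \<open>0 < p\<close> by (simp add: lp_gauge_zero)
next
  case (insert x A)
  let ?K = "lp_const p" and ?S = "\<Sum>i\<in>A. lp_gauge p (g i)"
  have K: "1 \<le> ?K" "1 \<le> ?K ^ card A"
    using lp_const_ge_1[of p] by (auto intro: one_le_power)
  have "lp_gauge p (\<lambda>t. \<Sum>i\<in>insert x A. g i t) = lp_gauge p (\<lambda>t. g x t + (\<Sum>i\<in>A. g i t))"
    using insert by simp
  also have "\<dots> \<le> ennreal ?K * (lp_gauge p (g x) + lp_gauge p (\<lambda>t. \<Sum>i\<in>A. g i t))"
    using insert by (intro lp_gauge_add \<open>0 < p\<close> borel_measurable_sum) auto
  also have "\<dots> \<le> ennreal ?K * (ennreal (?K ^ card A) * lp_gauge p (g x) + ennreal (?K ^ card A) * ?S)"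
    using insert K mult_right_mono[of 1 "ennreal (?K ^ card A)" "lp_gauge p (g x)"]
    by (intro mult_left_mono add_mono) auto
  also have "\<dots> = ennreal (?K ^ card (insert x A)) * (\<Sum>i\<in>insert x A. lp_gauge p (g i))"
    using insert K by (simp add: ennreal_mult distrib_left mult.assoc)
  finally show ?case .
qed

lemma lp_gauge_translation:
  assumes "0 < p" and [measurable]: "g \<in> borel_measurable lebesgue"
  shows "lp_gauge p (\<lambda>t. g (t + c)) \<le> lp_gauge p g"
proof (cases "p = \<infinity>")
  case True
  have "AE t in distr lebesgue lebesgue (\<lambda>t. t + c). g t \<le> esssup lebesgue g"
    unfolding lebesgue_translation_distr by (rule esssup_AE)
  then have "AE t in lebesgue. g (t + c) \<le> esssup lebesgue g"
    by (subst (asm) AE_distr_iff) measurable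
  moreover have "(\<lambda>t. g (t + c)) \<in> borel_measurable lebesgue"
    by measurable
  ultimately show ?thesis
    using True by (auto simp: lp_gauge_def intro!: esssup_I)
next
  case False
  let ?g = "\<lambda>t. ennreal_powr (g t) (enn2real p)"
  have "(\<integral>\<^sup>+t. ?g t \<partial>lebesgue) = (\<integral>\<^sup>+t. ?g t \<partial>distr lebesgue lebesgue (\<lambda>t. t + c))"
    by (simp add: lebesgue_translation_distr)
  also have "\<dots> = (\<integral>\<^sup>+t. ?g (t + c) \<partial>lebesgue)"
    by (subst nn_integral_distr) auto
  finally show ?thesis
    using False by (simp add: lp_gauge_def)
qed

text \<open>Extension by \<open>0\<close> is harmless for every exponent: \<open>0\<close> is the
  least value of \<open>ennreal\<close>, so points outside \<open>S\<close> do not raise an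
  essential supremum, and its powers vanish, so they add nothing to an integral.\<close>

lemma lp_qnorm_eq_lp_gauge:
  assumes "0 < p" and S [measurable]: "S \<in> sets lebesgue" and f: "f \<in> borel_measurable (lebesgue_on S)"
  shows "lp_qnorm p S f = lp_gauge p (\<lambda>t. indicator S t * ennreal (norm (f t)))"
    and "(\<lambda>t. indicator S t * ennreal (norm (f t))) \<in> borel_measurable lebesgue"
proof -
  have m: "(\<lambda>t. ennreal (norm (f t))) \<in> borel_measurable (lebesgue_on S)"
    using f by measurable
  then show m': "(\<lambda>t. indicator S t * ennreal (norm (f t))) \<in> borel_measurable lebesgue"
    by (subst (asm) borel_measurable_restrict_space_iff_ennreal) (auto simp: mult.commute)
  show "lp_qnorm p S f = lp_gauge p (\<lambda>t. indicator S t * ennreal (norm (f t)))"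
  proof (cases "p = \<infinity>")
    case True
    have "(AE t in lebesgue_on S. ennreal (norm (f t)) \<le> z)
        \<longleftrightarrow> (AE t in lebesgue. indicator S t * ennreal (norm (f t)) \<le> z)" for z
      by (subst AE_restrict_space_iff) (auto simp: indicator_def intro!: AE_cong)
    with True show ?thesis
      by (simp add: lp_qnorm_def lp_gauge_def esssup_eq_AE m m')
  next
    case False
    have "(\<integral>\<^sup>+t. ennreal_powr (ennreal (norm (f t))) (enn2real p) \<partial>lebesgue_on S)
        = (\<integral>\<^sup>+t. ennreal_powr (indicator S t * ennreal (norm (f t))) (enn2real p) \<partial>lebesgue)"
      by (subst nn_integral_restrict_space) (auto simp: indicator_def intro!: nn_integral_cong)
    with False show ?thesis
      by (simp add: lp_qnorm_def lp_gauge_def)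
  qed
qed

section \<open>Differences and translation polynomials\<close>

text \<open>\<open>P(T) f\<close>, where \<open>T\<close> is the translation by \<open>h\<close>; thus \<open>\<Delta>\<^sub>h\<^sup>k\<close> is \<open>(T - 1)\<^sup>k\<close>.\<close>

definition shift_op :: "real \<Rightarrow> real poly \<Rightarrow> (real \<Rightarrow> 'x::real_vector) \<Rightarrow> real \<Rightarrow> 'x" where
  "shift_op h P f t = (\<Sum>i\<le>degree P. coeff P i *\<^sub>R f (t + real i * h))"

lemma shift_op_eq:
  assumes "degree P \<le> n"
  shows "shift_op h P f t = (\<Sum>i\<le>n. coeff P i *\<^sub>R f (t + real i * h))"
  unfolding shift_op_def
  by (rule sum.mono_neutral_left) (use assms in \<open>auto simp: coeff_eq_0\<close>)

lemma shift_op_0 [simp]: "shift_op h 0 f t = 0"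
  by (simp add: shift_op_def)

lemma shift_op_1 [simp]: "shift_op h 1 f t = f t"
  by (simp add: shift_op_def)

lemma shift_op_pCons: "shift_op h (pCons c P) f t = c *\<^sub>R f t + shift_op h P f (t + h)"
proof -
  have "shift_op h (pCons c P) f t
      = (\<Sum>i\<le>Suc (degree P). coeff (pCons c P) i *\<^sub>R f (t + real i * h))"
    by (rule shift_op_eq) (rule degree_pCons_le)
  also have "\<dots> = c *\<^sub>R f t + (\<Sum>i\<le>degree P. coeff P i *\<^sub>R f (t + h + real i * h))"
    by (simp add: sum.atMost_Suc_shift algebra_simps del: sum.atMost_Suc)
  finally show ?thesis
    by (simp add: shift_op_def)
qed

lemma shift_op_add: "shift_op h (P + Q) f t = shift_op h P f t + shift_op h Q f t"
  by (simp add: shift_op_eq[of _ "max (degree P) (degree Q)"] degree_add_le_max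
      scaleR_left_distrib sum.distrib)

lemma shift_op_smult: "shift_op h (smult c P) f t = c *\<^sub>R shift_op h P f t"
  by (simp add: shift_op_eq[of _ "degree P"] degree_smult_le scaleR_sum_right)

lemma shift_op_diff: "shift_op h (P - Q) f t = shift_op h P f t - shift_op h Q f t"
proof -
  have "P - Q = P + smult (-1) Q"
    by simp
  then show ?thesis
    by (simp only: shift_op_add shift_op_smult) simp
qed

text \<open>With the rules for sums and scalars this makes \<open>P \<mapsto> P(T)\<close> a ring
  homomorphism, so polynomial identities turn into identities between differences.\<close>

lemma shift_op_mult: "shift_op h (P * Q) f t = shift_op h P (shift_op h Q f) t"
  by (induction P arbitrary: t)
    (simp_all add: mult_pCons_left shift_op_add shift_op_smult shift_op_pCons)

lemma shift_op_X_power: "shift_op h ([:0, 1:] ^ n) f t = f (t + real n * h)"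
  by (induction n arbitrary: t) (simp_all add: shift_op_mult shift_op_pCons algebra_simps)

text \<open>The same operator can come from different polynomials at different steps, such as
  \<open>x - 1\<close> at step \<open>N h\<close> and \<open>x ^ N - 1\<close> at step
  \<open>h\<close>. Agreement on all functions is assumed because the induction applies it to an
  already transformed \<open>f\<close>.\<close>

lemma shift_op_power_cong:
  fixes f :: "real \<Rightarrow> 'x::real_vector"
  assumes "\<And>(g :: real \<Rightarrow> 'x) t. shift_op h P g t = shift_op h' Q g t"
  shows "shift_op h (P ^ n) f t = shift_op h' (Q ^ n) f t"
proof (induction n arbitrary: t)
  case (Suc n)
  then have "shift_op h (P ^ n) f = shift_op h' (Q ^ n) f"
    by auto
  then show ?case
    by (simp add: shift_op_mult assms)
qed simp

lemma fin_diff_eq_shift_op: "fin_diff k h f t = shift_op h ([:-1, 1:] ^ k) f t"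
proof -
  have "shift_op h ([:-1, 1:] ^ k) f t = (\<Sum>i\<le>k. coeff ([:-1, 1:] ^ k) i *\<^sub>R f (t + real i * h))"
    by (rule shift_op_eq) (simp add: degree_linear_power)
  then show ?thesis
    by (simp add: fin_diff_def coeff_linear_poly_power atLeast0AtMost)
qed

lemma fin_diff_multiple_step:
  "fin_diff k (real N * h) f t = shift_op h (([:0, 1:] ^ N - 1) ^ k) f t"
  unfolding fin_diff_eq_shift_op
  by (rule shift_op_power_cong)
    (simp add: shift_op_pCons shift_op_diff shift_op_X_power)

text \<open>The algebraic core of Marchaud's inequality: \<open>(x\<^sup>N - 1)\<^sup>j\<close> and \<open>N\<^sup>j x\<^sup>e (x - 1)\<^sup>j\<close> have the same
  leading term at \<open>x = 1\<close>.\<close>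

lemma power_minus_one_expansion:
  assumes "0 < j" "2 \<le> N" "e \<le> j * (N - 1)"
  obtains R :: "real poly" where "degree R < j * (N - 1)"
    "smult (real N ^ j) ([:0, 1:] ^ e * [:-1, 1:] ^ j)
      = ([:0, 1:] ^ N - 1) ^ j - R * [:-1, 1:] ^ Suc j"
proof -
  define X :: "real poly" where "X = [:0, 1:]"
  define S :: "real poly" where "S = (\<Sum>i<N. X ^ i)"
  \<comment> \<open>\<open>S\<close> is the quotient of \<open>X ^ N - 1\<close> by
    \<open>X - 1\<close> and takes the value \<open>N\<close> at \<open>1\<close>. Hence
    \<open>T\<close> vanishes at \<open>1\<close> and is divisible by \<open>X - 1\<close>.\<close>
  define T where "T = S ^ j - smult (real N ^ j) (X ^ e)"
  have X1: "X - 1 = [:-1, 1:]"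
    by (simp add: X_def one_pCons)
  have fact: "X ^ N - 1 = [:-1, 1:] * S"
    using power_diff_1_eq[of X N] by (simp add: S_def X1)
  have dX: "degree (X ^ i) \<le> n" if "i \<le> n" for i n
    using degree_power_le[of X i] that by (simp add: X_def)
  have "degree (X ^ e) \<le> j * (N - 1)"
    using assms by (intro dX)
  moreover have "degree S \<le> N - 1"
    unfolding S_def by (intro degree_sum_le dX) auto
  moreover have "degree (S ^ j) \<le> degree S * j"
    by (rule degree_power_le)
  ultimately have deg: "degree T \<le> j * (N - 1)"
    unfolding T_def
    by (intro degree_diff_le) (auto simp: mult.commute intro: order_trans)
  have "poly T 1 = 0"
    by (simp add: T_def S_def X_def poly_sum)
  then obtain R where R: "T = [:-1, 1:] * R"
    using poly_eq_0_iff_dvd[of T 1] by (auto elim: dvdE)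
  have "degree R < j * (N - 1)"
  proof (cases "R = 0")
    case True
    then show ?thesis using assms by simp
  next
    case False
    then have "degree T = 1 + degree R"
      unfolding R by (subst degree_mult_eq) auto
    with deg show ?thesis by simp
  qed
  moreover have "(X ^ N - 1) ^ j - R * [:-1, 1:] ^ Suc j = [:-1, 1:] ^ j * (S ^ j - [:-1, 1:] * R)"
    by (simp only: fact power_mult_distrib power_Suc) (simp only: algebra_simps)
  moreover have "S ^ j - [:-1, 1:] * R = smult (real N ^ j) (X ^ e)"
    unfolding R[symmetric] T_def by simp
  moreover have "smult (real N ^ j) (X ^ e * Q) = Q * smult (real N ^ j) (X ^ e)" for Q
    by (simp only: mult_smult_right mult.commute[of _ Q])
  ultimately have "smult (real N ^ j) (X ^ e * [:-1, 1:] ^ j) = (X ^ N - 1) ^ j - R * [:-1, 1:] ^ Suc j"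
    by metis
  with \<open>degree R < j * (N - 1)\<close> show ?thesis
    unfolding X_def by (rule that)
qed

text \<open>The polynomial identity, applied to \<open>f\<close>: the factor \<open>x ^ e\<close>
  shifts the fine difference, \<open>(x ^ N - 1) ^ j\<close> is the coarse one, and the coefficients
  of the cofactor \<open>R\<close> give \<open>c\<close>. They depend on \<open>j\<close>,
  \<open>N\<close> and \<open>e\<close> only, which makes the later constants uniform in
  \<open>f\<close> and \<open>h\<close>.\<close>

lemma fin_diff_refine:
  assumes "0 < j" "2 \<le> N" "e \<le> j * (N - 1)"
  obtains c :: "nat \<Rightarrow> real" where
    "\<And>(f :: real \<Rightarrow> 'x::real_normed_vector) h t.
      real N ^ j * norm (fin_diff j h f (t + real e * h))
        \<le> norm (fin_diff j (real N * h) f t)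
          + (\<Sum>i<j * (N - 1). \<bar>c i\<bar> * norm (fin_diff (Suc j) h f (t + real i * h)))"
proof -
  obtain R :: "real poly" where deg: "degree R < j * (N - 1)"
    and R: "smult (real N ^ j) ([:0, 1:] ^ e * [:-1, 1:] ^ j)
      = ([:0, 1:] ^ N - 1) ^ j - R * [:-1, 1:] ^ Suc j"
    using power_minus_one_expansion[OF assms] by blast
  define m where "m = j * (N - 1) - 1"
  have m: "{..m} = {..<j * (N - 1)}" "degree R \<le> m"
    using deg by (auto simp: m_def)
  show ?thesis
  proof (rule that[of "coeff R"])
    fix f :: "real \<Rightarrow> 'x" and h t
    have D: "shift_op h ([:-1, 1:] ^ k) f = fin_diff k h f" for k
      by (simp add: fin_diff_eq_shift_op fun_eq_iff)
    have "real N ^ j *\<^sub>R fin_diff j h f (t + real e * h)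
        = shift_op h (smult (real N ^ j) ([:0, 1:] ^ e * [:-1, 1:] ^ j)) f t"
      by (simp add: shift_op_smult shift_op_mult shift_op_X_power D)
    also have "\<dots> = fin_diff j (real N * h) f t - shift_op h R (fin_diff (Suc j) h f) t"
      by (simp only: R shift_op_diff fin_diff_multiple_step shift_op_mult D)
    also have "shift_op h R (fin_diff (Suc j) h f) t
        = (\<Sum>i<j * (N - 1). coeff R i *\<^sub>R fin_diff (Suc j) h f (t + real i * h))"
      using shift_op_eq[OF m(2)] by (simp add: m(1))
    finally have eq: "real N ^ j *\<^sub>R fin_diff j h f (t + real e * h) =
      fin_diff j (real N * h) f t - (\<Sum>i<j * (N - 1). coeff R i *\<^sub>R fin_diff (Suc j) h f (t + real i * h))" .
    have "real N ^ j * norm (fin_diff j h f (t + real e * h))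
        = norm (real N ^ j *\<^sub>R fin_diff j h f (t + real e * h))"
      by simp
    also have "\<dots> \<le> norm (fin_diff j (real N * h) f t)
        + norm (\<Sum>i<j * (N - 1). coeff R i *\<^sub>R fin_diff (Suc j) h f (t + real i * h))"
      unfolding eq by (rule norm_triangle_ineq4)
    also have "norm (\<Sum>i<j * (N - 1). coeff R i *\<^sub>R fin_diff (Suc j) h f (t + real i * h))
        \<le> (\<Sum>i<j * (N - 1). \<bar>coeff R i\<bar> * norm (fin_diff (Suc j) h f (t + real i * h)))"
      by (rule sum_norm_le) simp
    finally show "real N ^ j * norm (fin_diff j h f (t + real e * h))
        \<le> norm (fin_diff j (real N * h) f t)
          + (\<Sum>i<j * (N - 1). \<bar>coeff R i\<bar> * norm (fin_diff (Suc j) h f (t + real i * h)))"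
      by simp
  qed
qed

section \<open>Refinement of differences without leaving the interval\<close>

definition abs_diff :: "real set \<Rightarrow> (real \<Rightarrow> 'x::real_normed_vector) \<Rightarrow> nat \<Rightarrow> real \<Rightarrow> real \<Rightarrow> real" where
  "abs_diff I f k h t = indicator (diff_dom I (real k * h)) t * norm (fin_diff k h f t)"

lemma abs_diff_nonneg [simp]: "0 \<le> abs_diff I f k h t"
  by (simp add: abs_diff_def)

text \<open>If the coarse difference based at \<open>t\<close> fits into \<open>I\<close>, so do all
  the finer ones in the expansion, and their norms may be replaced by the versions extended by
  \<open>0\<close>. The parameter \<open>e\<close> is later taken at its two extremes.\<close>

lemma abs_diff_refine_shifted:
  assumes "0 < j" "2 \<le> N" "e \<le> j * (N - 1)" "is_interval I"
  obtains c :: "nat \<Rightarrow> real" where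
    "\<And>(f :: real \<Rightarrow> 'x::real_normed_vector) h t. 0 < h \<Longrightarrow> t \<in> diff_dom I (real j * (real N * h)) \<Longrightarrow>
      real N ^ j * norm (fin_diff j h f (t + real e * h))
        \<le> abs_diff I f j (real N * h) t
          + (\<Sum>i<j * (N - 1). \<bar>c i\<bar> * abs_diff I f (Suc j) h (t + real i * h))"
proof -
  obtain c :: "nat \<Rightarrow> real" where c: "\<And>(f :: real \<Rightarrow> 'x::real_normed_vector) h t.
      real N ^ j * norm (fin_diff j h f (t + real e * h))
        \<le> norm (fin_diff j (real N * h) f t)
          + (\<Sum>i<j * (N - 1). \<bar>c i\<bar> * norm (fin_diff (Suc j) h f (t + real i * h)))"
    using fin_diff_refine[OF assms(1-3)] by blast
  show ?thesis
  proof (rule that[of c])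
    fix f :: "real \<Rightarrow> 'x" and h t
    assume h: "0 < h" and t: "t \<in> diff_dom I (real j * (real N * h))"
    have "t + real i * h \<in> diff_dom I (real (Suc j) * h)" if i: "i < j * (N - 1)" for i
    proof -
      \<comment> \<open>Equality holds for the largest \<open>i\<close>, namely
        \<open>j * (N - 1) - 1\<close>: the strict degree bound on the cofactor is just enough to
        keep the differences of order \<open>j + 1\<close> within the reach of the coarse
        difference.\<close>
      have "i + Suc j \<le> j * N"
        using i \<open>2 \<le> N\<close> by (cases N) auto
      then have "real (i + Suc j) \<le> real (j * N)"
        by (simp only: of_nat_le_iff)
      then have "real (i + Suc j) * h \<le> real (j * N) * h"
        using h by (intro mult_right_mono) auto
      then have le: "real i * h + real (Suc j) * h \<le> real j * (real N * h)"
        by (simp add: algebra_simps)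
      have *: "t + y \<in> I" if "0 \<le> y" "y \<le> real j * (real N * h)" for y
        using t that \<open>is_interval I\<close>[unfolded is_interval_1]
        by (auto simp: diff_dom_def)
      have "0 \<le> real i * h" "0 \<le> real (Suc j) * h"
        using h by auto
      then have "t + real i * h \<in> I" "t + (real i * h + real (Suc j) * h) \<in> I"
        using le by (auto intro!: *)
      then show ?thesis
        by (simp add: diff_dom_def add.assoc)
    qed
    then show "real N ^ j * norm (fin_diff j h f (t + real e * h))
        \<le> abs_diff I f j (real N * h) t
          + (\<Sum>i<j * (N - 1). \<bar>c i\<bar> * abs_diff I f (Suc j) h (t + real i * h))"
      using c[where f=f and h=h and t=t] t by (simp add: abs_diff_def)
  qed
qed

text \<open>If \<open>t + jNh\<close> leaves \<open>I\<close> on the right, then \<open>t - j(N - 1)h\<close> is still in \<open>I\<close>, and the expansion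
  is centred there instead; the right-hand side contains the terms of both cases.\<close>

lemma abs_diff_refine:
  assumes "0 < j" "2 \<le> N" "is_interval I" "{a..<a + l} \<subseteq> I" "I \<subseteq> {a..}"
  obtains c :: "nat \<Rightarrow> real" where "\<And>i. 0 \<le> c i"
    "\<And>(f :: real \<Rightarrow> 'x::real_normed_vector) h t. 0 < h \<Longrightarrow> 2 * real j * real N * h \<le> l \<Longrightarrow>
      abs_diff I f j h t
        \<le> 1 / real N ^ j * (abs_diff I f j (real N * h) t
              + abs_diff I f j (real N * h) (t - real (j * (N - 1)) * h))
          + (\<Sum>i<j * (N - 1). c i * (abs_diff I f (Suc j) h (t + real i * h)
              + abs_diff I f (Suc j) h (t + (real i - real (j * (N - 1))) * h)))"
proof -
  let ?m = "j * (N - 1)"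
  obtain c :: "nat \<Rightarrow> real" where c:
    "\<And>(f :: real \<Rightarrow> 'x) h t. 0 < h \<Longrightarrow> t \<in> diff_dom I (real j * (real N * h)) \<Longrightarrow>
      real N ^ j * norm (fin_diff j h f (t + real 0 * h))
        \<le> abs_diff I f j (real N * h) t
          + (\<Sum>i<?m. \<bar>c i\<bar> * abs_diff I f (Suc j) h (t + real i * h))"
    using abs_diff_refine_shifted[OF assms(1,2) _ assms(3), of 0] by blast
  obtain d :: "nat \<Rightarrow> real" where d:
    "\<And>(f :: real \<Rightarrow> 'x) h t. 0 < h \<Longrightarrow> t \<in> diff_dom I (real j * (real N * h)) \<Longrightarrow>
      real N ^ j * norm (fin_diff j h f (t + real ?m * h))
        \<le> abs_diff I f j (real N * h) t
          + (\<Sum>i<?m. \<bar>d i\<bar> * abs_diff I f (Suc j) h (t + real i * h))"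
    using abs_diff_refine_shifted[OF assms(1,2) order_refl assms(3)] by blast
  define b where "b i = (\<bar>c i\<bar> + \<bar>d i\<bar>) / real N ^ j" for i
  show ?thesis
  proof (rule that[of b])
    show "0 \<le> b i" for i
      by (simp add: b_def)
    fix f :: "real \<Rightarrow> 'x" and h t
    assume h: "0 < h" and l: "2 * real j * real N * h \<le> l"
    have N: "0 < real N ^ j"
      using \<open>2 \<le> N\<close> by simp
    have "0 < 2 * real j * real N * h"
      using h assms(1,2) by simp
    with l have l0: "0 < l"
      by linarith
    have m: "real ?m * h + real j * h = real j * (real N * h)"
      using \<open>2 \<le> N\<close> by (simp add: of_nat_diff algebra_simps)
    define t' where "t' = t - real ?m * h"
    let ?A = "abs_diff I f j (real N * h)" and ?B = "abs_diff I f (Suc j) h"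
    have nn: "0 \<le> (\<Sum>i<?m. \<bar>c i\<bar> * ?B (t' + real i * h))" "0 \<le> (\<Sum>i<?m. \<bar>d i\<bar> * ?B (t' + real i * h))"
      "0 \<le> (\<Sum>i<?m. \<bar>c i\<bar> * ?B (t + real i * h))" "0 \<le> (\<Sum>i<?m. \<bar>d i\<bar> * ?B (t + real i * h))"
      by (auto intro!: sum_nonneg)
    have "real N ^ j * abs_diff I f j h t
        \<le> (?A t + ?A t') + (\<Sum>i<?m. (\<bar>c i\<bar> + \<bar>d i\<bar>) * (?B (t + real i * h) + ?B (t' + real i * h)))"
      (is "_ \<le> ?rhs")
    proof (cases "t \<in> diff_dom I (real j * h)")
      case True
      then have t: "t \<in> I" "t + real j * h \<in> I"
        by (auto simp: diff_dom_def)
      have rhs: "?rhs = ?A t + ?A t' + (\<Sum>i<?m. \<bar>c i\<bar> * ?B (t + real i * h)) + (\<Sum>i<?m. \<bar>d i\<bar> * ?B (t + real i * h))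
          + (\<Sum>i<?m. \<bar>c i\<bar> * ?B (t' + real i * h)) + (\<Sum>i<?m. \<bar>d i\<bar> * ?B (t' + real i * h))"
        by (simp add: algebra_simps sum.distrib)
      have 0: "abs_diff I f j h t = norm (fin_diff j h f t)"
        using True by (simp add: abs_diff_def)
      show ?thesis
      \<comment> \<open>A coarse difference based at \<open>t'\<close> ends at
        \<open>t' + j N h = t + j h\<close>, which lies in \<open>I\<close> by assumption. So
        \<open>t' \<in> I\<close> suffices for the expansion with
        \<open>e = j * (N - 1)\<close>.\<close>
      proof (cases "t' \<in> I")
        case True
        then have "t' \<in> diff_dom I (real j * (real N * h))"
          using t unfolding diff_dom_def t'_def m[symmetric] by simp
        moreover have "t' + real ?m * h = t"
          by (simp add: t'_def)
        ultimately have "real N ^ j * norm (fin_diff j h f t)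
            \<le> ?A t' + (\<Sum>i<?m. \<bar>d i\<bar> * ?B (t' + real i * h))"
          using d[OF h, of t' f] by simp
        then show ?thesis
          unfolding rhs 0 using nn abs_diff_nonneg[of I f j "real N * h" t] by linarith
      next
        case False
        \<comment> \<open>Now \<open>t\<close> is within \<open>j (N - 1) h\<close> of the left end,
          hence \<open>t + j N h < a + 2 j N h \<le> a + l\<close>. This is the origin of the factor
          \<open>2\<close> in the restriction on \<open>h\<close>; it makes room for the expansion
          with \<open>e = 0\<close>.\<close>
        have "t' < a"
        proof (rule ccontr)
          assume "\<not> t' < a"
          moreover have "t' \<le> t"
            using h by (simp add: t'_def)
          moreover have "a \<in> I"
            using l0 assms(4) by auto
          ultimately have "t' \<in> I"
            using mem_is_interval_1_I[OF assms(3) _ t(1), of a t'] by simp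
          with False show False ..
        qed
        moreover have "0 < real j * h"
          using \<open>0 < j\<close> h by simp
        ultimately have "t + real j * (real N * h) < a + 2 * (real j * (real N * h))"
          using m t'_def by linarith
        moreover have "a \<le> t" "0 \<le> real j * (real N * h)"
          using t assms(5) h by auto
        ultimately have "t + real j * (real N * h) \<in> {a..<a + l}"
          using l by (simp add: algebra_simps)
        then have "t \<in> diff_dom I (real j * (real N * h))"
          using t assms(4) by (auto simp: diff_dom_def)
        then have "real N ^ j * norm (fin_diff j h f t)
            \<le> ?A t + (\<Sum>i<?m. \<bar>c i\<bar> * ?B (t + real i * h))"
          using c[OF h, of t f] by simp
        then show ?thesis
          unfolding rhs 0 using nn abs_diff_nonneg[of I f j "real N * h" t'] by linarith
      qed
    next
      case False
      then show ?thesis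
        by (auto simp: abs_diff_def[of I f j h] intro!: add_nonneg_nonneg sum_nonneg)
    qed
    then have "abs_diff I f j h t \<le> ?rhs / real N ^ j"
      using N by (simp add: field_simps)
    also have "\<dots> = 1 / real N ^ j * (?A t + ?A t') + (\<Sum>i<?m. b i * (?B (t + real i * h) + ?B (t' + real i * h)))"
      by (subst add_divide_distrib) (simp add: b_def sum_divide_distrib)
    finally have *: "abs_diff I f j h t
        \<le> 1 / real N ^ j * (?A t + ?A t') + (\<Sum>i<?m. b i * (?B (t + real i * h) + ?B (t' + real i * h)))" .
    have eq: "t' + real i * h = t + (real i - real ?m) * h" for i
      by (simp add: t'_def left_diff_distrib)
    show "abs_diff I f j h t
        \<le> 1 / real N ^ j * (?A t + ?A (t - real ?m * h))
          + (\<Sum>i<?m. b i * (?B (t + real i * h) + ?B (t + (real i - real ?m) * h)))"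
      using *[unfolded eq] unfolding t'_def .
  qed
qed

section \<open>Moduli of smoothness on an interval\<close>

text \<open>Translation invariance removes the shifts \<open>d i\<close> from the bound. This
  matters because they will be multiples of the step \<open>h\<close>, over which a supremum is
  taken.\<close>

lemma lp_gauge_sum_translates:
  assumes "0 < p" "finite A" "\<And>i. i \<in> A \<Longrightarrow> 0 \<le> c i"
    and [measurable]: "g \<in> borel_measurable lebesgue"
  shows "lp_gauge p (\<lambda>t. \<Sum>i\<in>A. ennreal (c i) * g (t + d i))
    \<le> ennreal (lp_const p ^ card A * (\<Sum>i\<in>A. c i)) * lp_gauge p g"
proof -
  have m [measurable]: "(\<lambda>t. g (t + d i)) \<in> borel_measurable lebesgue" for i
    by (rule measurable_compose[OF lebesgue_translation_measurable assms(4)])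
  have "lp_gauge p (\<lambda>t. \<Sum>i\<in>A. ennreal (c i) * g (t + d i))
      \<le> ennreal (lp_const p ^ card A) * (\<Sum>i\<in>A. lp_gauge p (\<lambda>t. ennreal (c i) * g (t + d i)))"
    by (rule lp_gauge_sum[OF \<open>0 < p\<close> \<open>finite A\<close>]) measurable
  also have "\<dots> \<le> ennreal (lp_const p ^ card A) * (\<Sum>i\<in>A. ennreal (c i) * lp_gauge p g)"
  proof (intro mult_left_mono sum_mono)
    fix i assume "i \<in> A"
    then have "lp_gauge p (\<lambda>t. ennreal (c i) * g (t + d i)) \<le> ennreal (c i) * lp_gauge p (\<lambda>t. g (t + d i))"
      by (intro lp_gauge_cmult assms m) auto
    also have "\<dots> \<le> ennreal (c i) * lp_gauge p g"
      by (intro mult_left_mono lp_gauge_translation assms) auto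
    finally show "lp_gauge p (\<lambda>t. ennreal (c i) * g (t + d i)) \<le> ennreal (c i) * lp_gauge p g" .
  qed auto
  also have "\<dots> = ennreal (lp_const p ^ card A * (\<Sum>i\<in>A. c i)) * lp_gauge p g"
    using lp_const_ge_1[of p] assms(3)
    by (simp add: ennreal_mult sum_nonneg sum_distrib_right[symmetric] mult.assoc sum_ennreal)
  finally show ?thesis .
qed

text \<open>Bounded and unbounded intervals are treated together: \<open>l\<close> is not the length
  of \<open>I\<close> but the length of some initial piece, the only quantitative information used
  about the size of \<open>I\<close> from below.\<close>

locale half_open_interval =
  fixes I :: "real set" and a l :: real
  assumes interval: "is_interval I"
    and lower: "I \<subseteq> {a..}"
    and l_pos: "0 < l"
    and initial: "{a..<a + l} \<subseteq> I"
begin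

lemma I_sets [measurable]: "I \<in> sets lebesgue"
  using real_interval_borel_measurable[OF interval] by (intro sets_completionI_sets) simp

lemma diff_dom_sets [measurable]: "diff_dom I d \<in> sets lebesgue"
proof -
  have "(\<lambda>t. t + d) -` I \<inter> space lebesgue \<in> sets lebesgue"
    by (rule measurable_sets[OF lebesgue_translation_measurable I_sets])
  moreover have "diff_dom I d = I \<inter> ((\<lambda>t. t + d) -` I \<inter> space lebesgue)"
    by (auto simp: diff_dom_def)
  ultimately show ?thesis
    by simp
qed

lemma intermediate_mem:
  assumes "t \<in> diff_dom I (real k * h)" "0 \<le> h" "i \<le> k"
  shows "t + real i * h \<in> I"
proof -
  have "real i * h \<le> real k * h"
    using assms by (intro mult_right_mono) auto
  then show ?thesis
    using assms mem_is_interval_1_I[OF interval, of t "t + real k * h" "t + real i * h"]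
    by (simp add: diff_dom_def)
qed

text \<open>As \<open>f\<close> is controlled on \<open>I\<close> only, it is first cut off to
  \<open>F\<close>; for \<open>t\<close> in the domain of the difference all sample points lie in
  \<open>I\<close>, so nothing changes there. Separability, in the form of a second countable
  topology, gives measurability of the finite sum.\<close>

lemma fin_diff_measurable:
  fixes f :: "real \<Rightarrow> 'x::{banach, second_countable_topology}"
  assumes "f \<in> borel_measurable (lebesgue_on I)" "0 \<le> h"
  shows "fin_diff k h f \<in> borel_measurable (lebesgue_on (diff_dom I (real k * h)))"
proof -
  define F where "F t = indicator I t *\<^sub>R f t" for t
  have F: "F \<in> borel_measurable lebesgue"
    using assms(1) unfolding F_def by (subst (asm) borel_measurable_restrict_space_iff) auto
  have [measurable]: "(\<lambda>t. F (t + c)) \<in> borel_measurable lebesgue" for c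
    by (rule measurable_compose[OF lebesgue_translation_measurable F])
  have "fin_diff k h F \<in> borel_measurable lebesgue"
    unfolding fin_diff_def by measurable
  then have "fin_diff k h F \<in> borel_measurable (lebesgue_on (diff_dom I (real k * h)))"
    by (rule measurable_restrict_space1)
  then show ?thesis
  proof (rule measurable_cong[THEN iffD1, rotated])
    fix t assume "t \<in> space (lebesgue_on (diff_dom I (real k * h)))"
    then have "t + real i * h \<in> I" if "i \<le> k" for i
      using that assms(2) by (intro intermediate_mem) auto
    then show "fin_diff k h F t = fin_diff k h f t"
      by (simp add: fin_diff_def F_def)
  qed
qed

lemma abs_diff_eq_lp_gauge:
  fixes f :: "real \<Rightarrow> 'x::{banach, second_countable_topology}"
  assumes "0 < p" "f \<in> borel_measurable (lebesgue_on I)" "0 \<le> h"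
  shows "lp_qnorm p (diff_dom I (real k * h)) (fin_diff k h f) = lp_gauge p (\<lambda>t. ennreal (abs_diff I f k h t))"
    and "(\<lambda>t. ennreal (abs_diff I f k h t)) \<in> borel_measurable lebesgue"
proof -
  have eq: "ennreal (abs_diff I f k h t)
      = indicator (diff_dom I (real k * h)) t * ennreal (norm (fin_diff k h f t))" for t
    by (simp add: abs_diff_def indicator_def)
  show "lp_qnorm p (diff_dom I (real k * h)) (fin_diff k h f) = lp_gauge p (\<lambda>t. ennreal (abs_diff I f k h t))"
    "(\<lambda>t. ennreal (abs_diff I f k h t)) \<in> borel_measurable lebesgue"
    unfolding eq
    by (intro lp_qnorm_eq_lp_gauge[OF assms(1)] fin_diff_measurable assms diff_dom_sets)+
qed

lemma lp_gauge_abs_diff_le_modulus: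
  fixes f :: "real \<Rightarrow> 'x::{banach, second_countable_topology}"
  assumes "0 < p" "f \<in> borel_measurable (lebesgue_on I)" "0 < h" "h \<le> u"
  shows "lp_gauge p (\<lambda>t. ennreal (abs_diff I f k h t)) \<le> modulus_smoothness k f I u p"
  using assms unfolding modulus_smoothness_def
  by (subst abs_diff_eq_lp_gauge(1)[OF assms(1,2), symmetric]) (auto intro: SUP_upper2)

lemma modulus_smoothness_leI:
  fixes f :: "real \<Rightarrow> 'x::{banach, second_countable_topology}"
  assumes "0 < p" "f \<in> borel_measurable (lebesgue_on I)"
    and "\<And>h. 0 < h \<Longrightarrow> h \<le> u \<Longrightarrow> lp_gauge p (\<lambda>t. ennreal (abs_diff I f k h t)) \<le> W"
  shows "modulus_smoothness k f I u p \<le> W"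
  unfolding modulus_smoothness_def
  using assms(3) by (intro SUP_least) (simp add: abs_diff_eq_lp_gauge(1)[OF assms(1,2)])

text \<open>A difference is a sum of \<open>k + 1\<close> translates of \<open>f\<close> with
  binomial weights. This trivial bound is uniform in \<open>u\<close> and takes over wherever
  \<open>u\<close> is not small.\<close>

lemma modulus_le_lp_qnorm:
  assumes "0 < p"
  obtains C where "0 \<le> C"
    "\<And>(f :: real \<Rightarrow> 'x::{banach, second_countable_topology}) u. f \<in> borel_measurable (lebesgue_on I) \<Longrightarrow>
      modulus_smoothness k f I u p \<le> ennreal C * lp_qnorm p I f"
proof
  define C where "C = lp_const p ^ card {..k} * (\<Sum>i\<le>k. real (k choose i))"
  show "0 \<le> C"
    using lp_const_ge_1[of p] by (auto simp: C_def intro!: mult_nonneg_nonneg sum_nonneg)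
  fix f :: "real \<Rightarrow> 'x" and u
  assume f: "f \<in> borel_measurable (lebesgue_on I)"
  define g where "g t = indicator I t * ennreal (norm (f t))" for t
  have g: "g \<in> borel_measurable lebesgue" "lp_qnorm p I f = lp_gauge p g"
    using lp_qnorm_eq_lp_gauge[OF assms I_sets f] unfolding g_def by auto
  show "modulus_smoothness k f I u p \<le> ennreal C * lp_qnorm p I f"
  proof (rule modulus_smoothness_leI[OF assms f])
    fix h :: real assume h: "0 < h"
    have "lp_gauge p (\<lambda>t. ennreal (abs_diff I f k h t))
        \<le> lp_gauge p (\<lambda>t. \<Sum>i\<le>k. ennreal (real (k choose i)) * g (t + real i * h))"
    proof (rule lp_gauge_mono[OF assms])
      show "(\<lambda>t. ennreal (abs_diff I f k h t)) \<in> borel_measurable lebesgue"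
        using h by (intro abs_diff_eq_lp_gauge(2)[OF assms f]) simp
      show "ennreal (abs_diff I f k h t) \<le> (\<Sum>i\<le>k. ennreal (real (k choose i)) * g (t + real i * h))" for t
      proof (cases "t \<in> diff_dom I (real k * h)")
        case True
        have "ennreal (abs_diff I f k h t) = ennreal (norm (fin_diff k h f t))"
          using True by (simp add: abs_diff_def)
        also have "\<dots> \<le> ennreal (\<Sum>i\<le>k. real (k choose i) * norm (f (t + real i * h)))"
          unfolding fin_diff_def atLeast0AtMost
          by (intro ennreal_leI sum_norm_le) (auto simp: abs_mult power_abs)
        also have "\<dots> = (\<Sum>i\<le>k. ennreal (real (k choose i) * norm (f (t + real i * h))))"
          by (simp add: sum_ennreal)
        also have "\<dots> = (\<Sum>i\<le>k. ennreal (real (k choose i)) * g (t + real i * h))"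
          using h intermediate_mem[OF True] by (intro sum.cong) (auto simp: g_def ennreal_mult)
        finally show ?thesis .
      qed (simp add: abs_diff_def)
    qed
    also have "\<dots> \<le> ennreal C * lp_gauge p g"
      unfolding C_def by (rule lp_gauge_sum_translates[OF assms]) (use g in auto)
    finally show "lp_gauge p (\<lambda>t. ennreal (abs_diff I f k h t)) \<le> ennreal C * lp_qnorm p I f"
      by (simp add: g)
  qed
qed

text \<open>Since \<open>K\<close> does not depend on \<open>N\<close>, a large \<open>N\<close> makes the step contractive on functions of decay
  \<open>u\<^sup>\<sigma>\<close> with \<open>\<sigma> < j\<close>, although \<open>L\<^sub>p\<close> is only quasi-normed for \<open>p < 1\<close>.\<close>

lemma modulus_refine:
  assumes "0 < p"
  obtains K :: real where "0 < K"
    "\<And>j N. 0 < j \<Longrightarrow> 2 \<le> N \<Longrightarrow> \<exists>D\<ge>0. \<forall>(f :: real \<Rightarrow> 'x::{banach, second_countable_topology}) u.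
      f \<in> borel_measurable (lebesgue_on I) \<longrightarrow> 2 * real j * real N * u \<le> l \<longrightarrow>
      modulus_smoothness j f I u p
        \<le> ennreal (K / real N ^ j) * modulus_smoothness j f I (real N * u) p
          + ennreal D * modulus_smoothness (Suc j) f I u p"
proof
  define q where "q = lp_const p"
  have q: "1 \<le> q"
    using lp_const_ge_1 by (simp add: q_def)
  \<comment> \<open>One \<open>q\<close> separates the coarse terms \<open>X\<close> from the rest
    \<open>Y\<close>; \<open>q ^ 2 * 2\<close> accounts for the two translates in \<open>X\<close>.
    That number does not grow with \<open>N\<close>, whereas the number of terms in \<open>Y\<close>
    does, which only affects \<open>D\<close>.\<close>
  define K where "K = q * (q ^ 2 * 2)"
  show "0 < K"
    using q by (simp add: K_def)
  fix j N :: nat assume j: "0 < j" and N: "2 \<le> N"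
  let ?m = "j * (N - 1)"
  obtain c :: "nat \<Rightarrow> real" where c: "\<And>i. 0 \<le> c i"
    and ref: "\<And>(f :: real \<Rightarrow> 'x) h t. 0 < h \<Longrightarrow> 2 * real j * real N * h \<le> l \<Longrightarrow>
      abs_diff I f j h t
        \<le> 1 / real N ^ j * (abs_diff I f j (real N * h) t
              + abs_diff I f j (real N * h) (t - real ?m * h))
          + (\<Sum>i<?m. c i * (abs_diff I f (Suc j) h (t + real i * h)
              + abs_diff I f (Suc j) h (t + (real i - real ?m) * h)))"
    using abs_diff_refine[OF j N interval initial lower] by blast
  \<comment> \<open>The second component selects the centre of the expansion, \<open>0\<close> for
    \<open>t\<close> and \<open>1\<close> for \<open>t - j (N - 1) h\<close>, so that both families
    form one sum of translates.\<close>
  define B where "B = {..<?m} \<times> {0, 1 :: real}"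
  define D where "D = q * (q ^ card B * (\<Sum>x\<in>B. c (fst x)))"
  have B: "finite B"
    by (simp add: B_def)
  have D: "0 \<le> D"
    using q c by (auto simp: D_def intro!: mult_nonneg_nonneg sum_nonneg)
  have "modulus_smoothness j f I u p
        \<le> ennreal (K / real N ^ j) * modulus_smoothness j f I (real N * u) p
          + ennreal D * modulus_smoothness (Suc j) f I u p"
    if f: "f \<in> borel_measurable (lebesgue_on I)" and u: "2 * real j * real N * u \<le> l"
    for f :: "real \<Rightarrow> 'x" and u
  proof (rule modulus_smoothness_leI[OF assms f])
    fix h :: real assume h: "0 < h" "h \<le> u"
    have hl: "2 * real j * real N * h \<le> l"
      using h u by (intro order_trans[OF _ u] mult_left_mono) auto
    define F where "F t = ennreal (abs_diff I f j (real N * h) t)" for t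
    define G where "G t = ennreal (abs_diff I f (Suc j) h t)" for t
    have F [measurable]: "F \<in> borel_measurable lebesgue"
      unfolding F_def using h by (intro abs_diff_eq_lp_gauge(2)[OF assms f]) simp
    have G [measurable]: "G \<in> borel_measurable lebesgue"
      unfolding G_def using h by (intro abs_diff_eq_lp_gauge(2)[OF assms f]) simp
    have [measurable]: "(\<lambda>t. F (t + d)) \<in> borel_measurable lebesgue"
      "(\<lambda>t. G (t + d)) \<in> borel_measurable lebesgue" for d
      by (rule measurable_compose[OF lebesgue_translation_measurable], fact)+
    define X where "X t = (\<Sum>b\<in>{0, 1}. ennreal (1 / real N ^ j) * F (t + - (b * real ?m * h)))" for t
    define Y where "Y t = (\<Sum>x\<in>B. ennreal (c (fst x)) * G (t + (real (fst x) - snd x * real ?m) * h))" for t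
    have [measurable]: "X \<in> borel_measurable lebesgue" "Y \<in> borel_measurable lebesgue"
      unfolding X_def Y_def by measurable
    have "lp_gauge p (\<lambda>t. ennreal (abs_diff I f j h t)) \<le> lp_gauge p (\<lambda>t. X t + Y t)"
    proof (rule lp_gauge_mono[OF assms])
      show "(\<lambda>t. ennreal (abs_diff I f j h t)) \<in> borel_measurable lebesgue"
        using h by (intro abs_diff_eq_lp_gauge(2)[OF assms f]) simp
      fix t
      let ?A = "abs_diff I f j (real N * h)" and ?B = "abs_diff I f (Suc j) h"
      have "ennreal (abs_diff I f j h t) \<le> ennreal (1 / real N ^ j * (?A t + ?A (t - real ?m * h))
          + (\<Sum>i<?m. c i * (?B (t + real i * h) + ?B (t + (real i - real ?m) * h))))"
        by (intro ennreal_leI ref h hl)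
      also have "\<dots> = ennreal (1 / real N ^ j * (?A t + ?A (t - real ?m * h)))
          + ennreal (\<Sum>i<?m. c i * (?B (t + real i * h) + ?B (t + (real i - real ?m) * h)))"
        using c by (intro ennreal_plus mult_nonneg_nonneg sum_nonneg add_nonneg_nonneg) auto
      also have "ennreal (1 / real N ^ j * (?A t + ?A (t - real ?m * h))) = X t"
        unfolding X_def F_def by (subst ennreal_mult) (simp_all add: distrib_left)
      also have "ennreal (\<Sum>i<?m. c i * (?B (t + real i * h) + ?B (t + (real i - real ?m) * h)))
          = (\<Sum>i<?m. ennreal (c i) * (G (t + real i * h) + G (t + (real i - real ?m) * h)))"
        unfolding G_def using c by (subst sum_ennreal[symmetric]) (auto simp: ennreal_mult)
      also have "\<dots> = (\<Sum>i<?m. \<Sum>b\<in>{0, 1}. ennreal (c i) * G (t + (real i - b * real ?m) * h))"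
        by (simp add: distrib_left)
      also have "\<dots> = Y t"
        unfolding Y_def B_def by (subst sum.cartesian_product) (simp add: case_prod_unfold)
      finally show "ennreal (abs_diff I f j h t) \<le> X t + Y t" .
    qed
    also have "\<dots> \<le> ennreal q * (lp_gauge p X + lp_gauge p Y)"
      unfolding q_def by (intro lp_gauge_add assms) measurable
    also have "\<dots> \<le> ennreal q * (ennreal (q ^ 2 * (2 / real N ^ j)) * lp_gauge p F
        + ennreal (q ^ card B * (\<Sum>x\<in>B. c (fst x))) * lp_gauge p G)"
    proof (intro mult_left_mono add_mono)
      have "lp_gauge p X \<le> ennreal (lp_const p ^ card {0, 1::real} * (\<Sum>b\<in>{0, 1::real}. 1 / real N ^ j)) * lp_gauge p F"
        unfolding X_def by (rule lp_gauge_sum_translates[OF assms]) auto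
      then show "lp_gauge p X \<le> ennreal (q ^ 2 * (2 / real N ^ j)) * lp_gauge p F"
        by (simp add: q_def power2_eq_square)
      show "lp_gauge p Y \<le> ennreal (q ^ card B * (\<Sum>x\<in>B. c (fst x))) * lp_gauge p G"
        unfolding Y_def q_def by (rule lp_gauge_sum_translates[OF assms]) (use B c in auto)
    qed auto
    also have "\<dots> = ennreal (K / real N ^ j) * lp_gauge p F + ennreal D * lp_gauge p G"
    proof -
      have "ennreal q * ennreal (q ^ 2 * (2 / real N ^ j)) = ennreal (K / real N ^ j)"
        using q by (simp add: K_def flip: ennreal_mult)
      moreover have "ennreal q * ennreal (q ^ card B * (\<Sum>x\<in>B. c (fst x))) = ennreal D"
        unfolding D_def using q c by (intro ennreal_mult[symmetric]) (auto intro!: mult_nonneg_nonneg sum_nonneg)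
      ultimately show ?thesis
        by (simp add: distrib_left mult.assoc[symmetric])
    qed
    also have "\<dots> \<le> ennreal (K / real N ^ j) * modulus_smoothness j f I (real N * u) p
          + ennreal D * modulus_smoothness (Suc j) f I u p"
      unfolding F_def G_def using h N
      by (intro add_mono mult_left_mono lp_gauge_abs_diff_le_modulus assms f) auto
    finally show "lp_gauge p (\<lambda>t. ennreal (abs_diff I f j h t))
      \<le> ennreal (K / real N ^ j) * modulus_smoothness j f I (real N * u) p
          + ennreal D * modulus_smoothness (Suc j) f I u p" .
  qed
  with D show "\<exists>D\<ge>0. \<forall>(f :: real \<Rightarrow> 'x) u.
      f \<in> borel_measurable (lebesgue_on I) \<longrightarrow> 2 * real j * real N * u \<le> l \<longrightarrow>
      modulus_smoothness j f I u p
        \<le> ennreal (K / real N ^ j) * modulus_smoothness j f I (real N * u) p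
          + ennreal D * modulus_smoothness (Suc j) f I u p"
    by blast
qed

end

section \<open>Transfer of decay to differences of lower order\<close>

lemma modulus_mono: "u \<le> v \<Longrightarrow> modulus_smoothness k f I u p \<le> modulus_smoothness k f I v p"
  unfolding modulus_smoothness_def by (rule SUP_subset_mono) auto

context half_open_interval
begin

text \<open>Because \<open>\<sigma> < j\<close>, some \<open>N\<close> satisfies
  \<open>K * N powr (\<sigma> - j) < 1 / 2\<close>. The bound at scale \<open>N u\<close> then
  implies the one at \<open>u\<close> with the same \<open>B\<close>, and the induction runs over
  the number of multiplications by \<open>N\<close> that lift \<open>u\<close> to \<open>u0\<close>.
  Keeping \<open>M\<close> as a free upper bound for the quasi-norm allows it to be the full Besov
  norm.\<close>

lemma modulus_decay_step:
  assumes "0 < p" "0 < j" "0 \<le> \<sigma>" "\<sigma> < real j" "0 \<le> A"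
  obtains B where "0 \<le> B"
    "\<And>(f :: real \<Rightarrow> 'x::{banach, second_countable_topology}) M u.
      f \<in> borel_measurable (lebesgue_on I) \<Longrightarrow> lp_qnorm p I f \<le> M \<Longrightarrow>
      (\<And>u. 0 < u \<Longrightarrow> modulus_smoothness (Suc j) f I u p \<le> ennreal (A * u powr \<sigma>) * M) \<Longrightarrow>
      0 < u \<Longrightarrow> modulus_smoothness j f I u p \<le> ennreal (B * u powr \<sigma>) * M"
proof -
  obtain K where K: "0 < K" and ref:
    "\<And>j N. 0 < j \<Longrightarrow> 2 \<le> N \<Longrightarrow> \<exists>D\<ge>0. \<forall>(f :: real \<Rightarrow> 'x) u.
      f \<in> borel_measurable (lebesgue_on I) \<longrightarrow> 2 * real j * real N * u \<le> l \<longrightarrow>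
      modulus_smoothness j f I u p
        \<le> ennreal (K / real N ^ j) * modulus_smoothness j f I (real N * u) p
          + ennreal D * modulus_smoothness (Suc j) f I u p"
    using modulus_refine[OF assms(1)] by blast
  obtain C where C: "0 \<le> C" "\<And>(f :: real \<Rightarrow> 'x) u. f \<in> borel_measurable (lebesgue_on I) \<Longrightarrow>
      modulus_smoothness j f I u p \<le> ennreal C * lp_qnorm p I f"
    using modulus_le_lp_qnorm[OF assms(1), of j] by blast
  have "((\<lambda>N. real N powr (\<sigma> - real j)) \<longlongrightarrow> 0) sequentially"
    using assms by (intro tendsto_neg_powr filterlim_real_sequentially) auto
  then have "eventually (\<lambda>N. real N powr (\<sigma> - real j) < 1 / (2 * K)) sequentially"
    using K by (intro order_tendstoD(2)) auto
  then have "eventually (\<lambda>N. real N powr (\<sigma> - real j) < 1 / (2 * K) \<and> 2 \<le> N) sequentially"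
    using eventually_ge_at_top[of 2] by eventually_elim simp
  then obtain N where N: "2 \<le> N" "real N powr (\<sigma> - real j) < 1 / (2 * K)"
    by (auto simp: eventually_sequentially)
  obtain D where D: "0 \<le> D" and refN: "\<And>(f :: real \<Rightarrow> 'x) u.
      f \<in> borel_measurable (lebesgue_on I) \<Longrightarrow> 2 * real j * real N * u \<le> l \<Longrightarrow>
      modulus_smoothness j f I u p
        \<le> ennreal (K / real N ^ j) * modulus_smoothness j f I (real N * u) p
          + ennreal D * modulus_smoothness (Suc j) f I u p"
    using ref[OF \<open>0 < j\<close> N(1)] by blast
  \<comment> \<open>The largest scale at which the refinement inequality is available.\<close>
  define u0 where "u0 = l / (2 * real j * real N)"
  have u0: "0 < u0"
    using l_pos \<open>0 < j\<close> N by (simp add: u0_def)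
  \<comment> \<open>The first summand gives \<open>B / 2 + D * A \<le> B\<close>, which closes the
    induction; the second lifts the trivial bound \<open>C\<close> to
    \<open>B * u powr \<sigma>\<close> for all \<open>u \<ge> u0\<close>.\<close>
  define B where "B = 2 * D * A + C * u0 powr - \<sigma>"
  have B: "0 \<le> B"
    using D C assms by (simp add: B_def)
  show ?thesis
  proof (rule that[OF B])
    fix f :: "real \<Rightarrow> 'x" and M and u :: real
    assume f: "f \<in> borel_measurable (lebesgue_on I)" and M: "lp_qnorm p I f \<le> M"
      and decay: "\<And>u. 0 < u \<Longrightarrow> modulus_smoothness (Suc j) f I u p \<le> ennreal (A * u powr \<sigma>) * M"
      and "0 < u"
    have large: "modulus_smoothness j f I u p \<le> ennreal (B * u powr \<sigma>) * M" if "u0 \<le> u" for u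
    proof -
      have "C * 1 \<le> C * (u0 powr - \<sigma> * u powr \<sigma>)"
        using that u0 C powr_mono2[OF \<open>0 \<le> \<sigma>\<close> _ that]
        by (intro mult_left_mono) (auto simp: powr_minus field_simps)
      also have "\<dots> \<le> B * u powr \<sigma>"
        using D assms by (simp add: B_def distrib_right mult.assoc)
      finally have "ennreal C \<le> ennreal (B * u powr \<sigma>)"
        by (intro ennreal_leI) simp
      then have "ennreal C * lp_qnorm p I f \<le> ennreal (B * u powr \<sigma>) * M"
        using M by (rule mult_mono) auto
      with C(2)[OF f] show ?thesis
        by (rule order_trans)
    qed
    have small: "modulus_smoothness j f I u p \<le> ennreal (B * u powr \<sigma>) * M"
      if "0 < u" "u0 \<le> real N ^ n * u" for n u
      using that
    proof (induction n arbitrary: u)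
      case 0
      then show ?case using large by simp
    next
      case (Suc n)
      show ?case
      proof (cases "u0 \<le> u")
        case True
        then show ?thesis by (rule large)
      next
        case False
        then have "2 * real j * real N * u \<le> l"
          using \<open>0 < j\<close> N by (simp add: u0_def field_simps)
        then have "modulus_smoothness j f I u p
            \<le> ennreal (K / real N ^ j) * modulus_smoothness j f I (real N * u) p
              + ennreal D * modulus_smoothness (Suc j) f I u p"
          by (rule refN[OF f])
        also have "\<dots> \<le> ennreal (K / real N ^ j) * (ennreal (B * (real N * u) powr \<sigma>) * M)
              + ennreal D * (ennreal (A * u powr \<sigma>) * M)"
          using Suc N by (intro add_mono mult_left_mono decay Suc.IH) (auto simp: mult_ac)
        also have "\<dots> = ennreal (K / real N ^ j * (B * (real N * u) powr \<sigma>) + D * (A * u powr \<sigma>)) * M"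
          using K B D \<open>0 \<le> A\<close> by (simp add: ennreal_mult[symmetric] mult.assoc[symmetric] distrib_right)
        also have "\<dots> \<le> ennreal (B * u powr \<sigma>) * M"
        proof (intro mult_right_mono ennreal_leI)
          have "K / real N ^ j * (B * (real N * u) powr \<sigma>) = K * real N powr (\<sigma> - real j) * B * u powr \<sigma>"
            using N Suc.prems by (simp add: powr_mult powr_diff powr_realpow)
          also have "\<dots> \<le> 1 / 2 * B * u powr \<sigma>"
            using N K B by (intro mult_right_mono) (auto simp: field_simps)
          finally have "K / real N ^ j * (B * (real N * u) powr \<sigma>) + D * (A * u powr \<sigma>)
              \<le> (B / 2 + D * A) * u powr \<sigma>"
            by (simp add: algebra_simps)
          also have "\<dots> \<le> B * u powr \<sigma>"
            using C by (intro mult_right_mono) (auto simp: B_def)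
          finally show "K / real N ^ j * (B * (real N * u) powr \<sigma>) + D * (A * u powr \<sigma>) \<le> B * u powr \<sigma>" .
        qed auto
        finally show ?thesis .
      qed
    qed
    obtain n where "u0 / u < real N ^ n"
      using real_arch_pow[of "real N" "u0 / u"] N by auto
    then have "u0 \<le> real N ^ n * u"
      using \<open>0 < u\<close> by (simp add: field_simps)
    with \<open>0 < u\<close> show "modulus_smoothness j f I u p \<le> ennreal (B * u powr \<sigma>) * M"
      by (rule small)
  qed
qed

text \<open>The order descends from \<open>k\<close> to \<open>j\<close> one at a time. Since
  \<open>\<sigma> < j\<close>, the exponent stays below every intermediate order. The constant is
  quantified inside the statement because it changes at each descent while remaining independent of
  \<open>f\<close>.\<close>

lemma modulus_decay:
  assumes "0 < p" "0 < j" "j \<le> k" "0 \<le> \<sigma>" "\<sigma> < real j" "0 \<le> A"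
  shows "\<exists>B\<ge>0. \<forall>(f :: real \<Rightarrow> 'x::{banach, second_countable_topology}) M.
      f \<in> borel_measurable (lebesgue_on I) \<longrightarrow> lp_qnorm p I f \<le> M \<longrightarrow>
      (\<forall>u>0. modulus_smoothness k f I u p \<le> ennreal (A * u powr \<sigma>) * M) \<longrightarrow>
      (\<forall>u>0. modulus_smoothness j f I u p \<le> ennreal (B * u powr \<sigma>) * M)"
  using \<open>j \<le> k\<close>
proof (induction rule: inc_induct)
  case base
  show ?case using \<open>0 \<le> A\<close> by blast
next
  case (step n)
  then obtain B where B: "0 \<le> B" and bound: "\<forall>(f :: real \<Rightarrow> 'x) M.
      f \<in> borel_measurable (lebesgue_on I) \<longrightarrow> lp_qnorm p I f \<le> M \<longrightarrow>
      (\<forall>u>0. modulus_smoothness k f I u p \<le> ennreal (A * u powr \<sigma>) * M) \<longrightarrow>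
      (\<forall>u>0. modulus_smoothness (Suc n) f I u p \<le> ennreal (B * u powr \<sigma>) * M)"
    by metis
  have n: "0 < n" "\<sigma> < real n"
    using step assms by linarith+
  obtain B' where B': "0 \<le> B'" and bound': "\<And>(f :: real \<Rightarrow> 'x) M u.
      f \<in> borel_measurable (lebesgue_on I) \<Longrightarrow> lp_qnorm p I f \<le> M \<Longrightarrow>
      (\<And>u. 0 < u \<Longrightarrow> modulus_smoothness (Suc n) f I u p \<le> ennreal (B * u powr \<sigma>) * M) \<Longrightarrow>
      0 < u \<Longrightarrow> modulus_smoothness n f I u p \<le> ennreal (B' * u powr \<sigma>) * M"
    using modulus_decay_step[OF \<open>0 < p\<close> n(1) \<open>0 \<le> \<sigma>\<close> n(2) B, where 'x = 'x] by blast
  show ?case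
  proof (intro exI[of _ B'] conjI allI impI B')
    fix f :: "real \<Rightarrow> 'x" and M and u :: real
    assume f: "f \<in> borel_measurable (lebesgue_on I)" "lp_qnorm p I f \<le> M"
      and decay: "\<forall>u>0. modulus_smoothness k f I u p \<le> ennreal (A * u powr \<sigma>) * M" and "0 < u"
    have "modulus_smoothness (Suc n) f I v p \<le> ennreal (B * v powr \<sigma>) * M" if "0 < v" for v
      using bound f decay that by metis
    then show "modulus_smoothness n f I u p \<le> ennreal (B' * u powr \<sigma>) * M"
      using bound'[OF f] \<open>0 < u\<close> by metis
  qed
qed

end

text \<open>Superlevel sets of a monotone function are intervals. This yields measurability of the
  modulus in \<open>u\<close>, although it is a supremum over uncountably many steps.\<close>

lemma borel_measurable_mono_ennreal:
  fixes f :: "real \<Rightarrow> ennreal"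
  assumes "mono f"
  shows "f \<in> borel_measurable borel"
proof (rule borel_measurableI_greater)
  fix y
  have "is_interval {x. y < f x}"
    unfolding is_interval_1 using monoD[OF assms] by (blast intro: less_le_trans)
  then show "{x \<in> space borel. y < f x} \<in> sets borel"
    by (simp add: real_interval_borel_measurable)
qed

lemma modulus_measurable [measurable]:
  "(\<lambda>u. modulus_smoothness k f I u p) \<in> borel_measurable borel"
  by (intro borel_measurable_mono_ennreal monoI modulus_mono)

section \<open>The constituents of the Besov seminorm\<close>

definition besov_order :: "real \<Rightarrow> nat" where
  "besov_order s = nat \<lfloor>s\<rfloor> + 1"

lemma besov_order_gt: "s < real (besov_order s)"
  unfolding besov_order_def by linarith

lemma besov_order_pos: "0 < besov_order s"
  by (simp add: besov_order_def)

lemma besov_order_mono: "s \<le> t \<Longrightarrow> besov_order s \<le> besov_order t"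
  by (simp add: besov_order_def nat_mono floor_mono)

definition besov_range :: "real \<Rightarrow> real set \<Rightarrow> real set" where
  "besov_range s I = {u. 0 < u \<and> ennreal u < emeasure lebesgue I / of_nat (besov_order s)}"

definition besov_quotient :: "real \<Rightarrow> ennreal \<Rightarrow> real set \<Rightarrow> (real \<Rightarrow> 'x::real_normed_vector) \<Rightarrow> real \<Rightarrow> ennreal" where
  "besov_quotient s p I f u = ennreal (u powr - s) * modulus_smoothness (besov_order s) f I u p"

lemma besov_quotient_measurable [measurable]: "besov_quotient s p I f \<in> borel_measurable borel"
  unfolding besov_quotient_def by measurable

lemma besov_range_measurable [measurable]: "besov_range s I \<in> sets borel"
  unfolding besov_range_def by measurable

lemma besov_seminorm_infinity:
  "besov_seminorm s p \<infinity> I f = (SUP u\<in>besov_range s I. besov_quotient s p I f u)"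
  by (simp add: besov_seminorm_def besov_range_def besov_quotient_def besov_order_def)

text \<open>The integrand and the range are Borel, so restricted Lebesgue measure can be replaced by
  \<open>lborel\<close> with an indicator.\<close>

definition besov_integral ::
    "real \<Rightarrow> ennreal \<Rightarrow> real \<Rightarrow> real set \<Rightarrow> (real \<Rightarrow> 'x::real_normed_vector) \<Rightarrow> ennreal" where
  "besov_integral s p r I f =
     (\<integral>\<^sup>+u. ennreal_powr (besov_quotient s p I f u) r / ennreal u * indicator (besov_range s I) u \<partial>lborel)"

lemma besov_seminorm_finite:
  assumes "q \<noteq> \<infinity>"
  shows "besov_seminorm s p q I f = ennreal_powr (besov_integral s p (enn2real q) I f) (1 / enn2real q)"
proof -
  have U: "besov_range s I \<in> sets lebesgue"
    using besov_range_measurable by (intro sets_completionI_sets) simp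
  have "besov_seminorm s p q I f = ennreal_powr
      (\<integral>\<^sup>+u. ennreal_powr (besov_quotient s p I f u) (enn2real q) / ennreal u \<partial>lebesgue_on (besov_range s I))
      (1 / enn2real q)"
    using assms by (simp add: besov_seminorm_def besov_range_def besov_quotient_def besov_order_def Let_def)
  also have "(\<integral>\<^sup>+u. ennreal_powr (besov_quotient s p I f u) (enn2real q) / ennreal u \<partial>lebesgue_on (besov_range s I))
      = besov_integral s p (enn2real q) I f"
    using U by (subst nn_integral_restrict_space) (simp_all add: nn_integral_completion besov_integral_def)
  finally show ?thesis .
qed

definition besov_norm :: "real \<Rightarrow> ennreal \<Rightarrow> ennreal \<Rightarrow> real set \<Rightarrow> (real \<Rightarrow> 'x::real_normed_vector) \<Rightarrow> ennreal" where
  "besov_norm s p q I f = lp_qnorm p I f + besov_seminorm s p q I f"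

lemma lp_qnorm_le_besov_norm: "lp_qnorm p I f \<le> besov_norm s p q I f"
  and besov_seminorm_le_besov_norm: "besov_seminorm s p q I f \<le> besov_norm s p q I f"
  by (simp_all add: besov_norm_def)

text \<open>Two inequalities for measurable \<open>f\<close> suffice, without finiteness
  assumptions: a finite right-hand side gives the inclusion, and adding the inequalities gives the
  constant \<open>C + C'\<close>.\<close>

lemma besov_embeddingI:
  fixes I :: "real set"
  assumes "0 \<le> C" "0 \<le> C'"
    and "\<And>f :: real \<Rightarrow> 'x::real_normed_vector. f \<in> borel_measurable (lebesgue_on I) \<Longrightarrow>
      lp_qnorm p' I f \<le> ennreal C * besov_norm s p q I f"
    and "\<And>f :: real \<Rightarrow> 'x. f \<in> borel_measurable (lebesgue_on I) \<Longrightarrow>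
      besov_seminorm s' p' q' I f \<le> ennreal C' * besov_norm s p q I f"
  shows "(besov s p q I :: (real \<Rightarrow> 'x) qnormed) \<hookrightarrow> besov s' p' q' I"
  unfolding cont_embedded_def
proof (intro conjI exI[of _ "C + C'"] ballI subsetI)
  fix f :: "real \<Rightarrow> 'x"
  assume f: "f \<in> fst (besov s p q I)"
  then have m: "f \<in> borel_measurable (lebesgue_on I)"
    by (simp add: besov_def lp_set_def)
  have "besov_norm s p q I f < top"
    using f by (simp add: besov_def lp_set_def besov_norm_def)
  then have "ennreal C * besov_norm s p q I f < top" "ennreal C' * besov_norm s p q I f < top"
    by (simp_all add: ennreal_mult_less_top)
  then show "f \<in> fst (besov s' p' q' I)"
    using assms(3)[OF m] assms(4)[OF m] m by (auto simp: besov_def lp_set_def intro: le_less_trans)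
  show "snd (besov s' p' q' I) f \<le> ennreal (C + C') * snd (besov s p q I) f"
    using add_mono[OF assms(3)[OF m] assms(4)[OF m]] assms(1,2)
    by (simp add: besov_def besov_norm_def[symmetric] distrib_right)
qed (use assms in simp)

section \<open>Embeddings of Besov spaces\<close>

lemma besov_seminorm_scale:
  assumes "0 < q'" "0 \<le> c"
    and "\<And>u. modulus_smoothness (besov_order s) f I u p' \<le> ennreal c * modulus_smoothness (besov_order s) f I u p"
  shows "besov_seminorm s p' q' I f \<le> ennreal c * besov_seminorm s p q' I f"
proof -
  have le: "besov_quotient s p' I f u \<le> ennreal c * besov_quotient s p I f u" for u
    using mult_left_mono[OF assms(3)[of u], of "ennreal (u powr - s)"]
    by (simp add: besov_quotient_def mult_ac)
  show ?thesis
  proof (cases "q' = \<infinity>")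
    case True
    show ?thesis
      unfolding True besov_seminorm_infinity
      by (intro SUP_least order_trans[OF le] mult_left_mono SUP_upper) auto
  next
    case False
    define r where "r = enn2real q'"
    have r: "0 < r"
      using enn2real_pos[OF assms(1) False] by (simp add: r_def)
    have "besov_integral s p' r I f
        \<le> (\<integral>\<^sup>+u. ennreal_powr (ennreal c) r *
            (ennreal_powr (besov_quotient s p I f u) r / ennreal u * indicator (besov_range s I) u) \<partial>lborel)"
      unfolding besov_integral_def
    proof (rule nn_integral_mono)
      fix u
      have "ennreal_powr (besov_quotient s p' I f u) r \<le> ennreal_powr (ennreal c) r * ennreal_powr (besov_quotient s p I f u) r"
        using r le[of u] unfolding ennreal_powr_mult[symmetric] by (intro ennreal_powr_mono) auto
      then have "ennreal_powr (besov_quotient s p' I f u) r / ennreal u * indicator (besov_range s I) u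
        \<le> (ennreal_powr (ennreal c) r * ennreal_powr (besov_quotient s p I f u) r) / ennreal u * indicator (besov_range s I) u"
        by (intro mult_right_mono divide_right_mono_ennreal) auto
      then show "ennreal_powr (besov_quotient s p' I f u) r / ennreal u * indicator (besov_range s I) u
        \<le> ennreal_powr (ennreal c) r * (ennreal_powr (besov_quotient s p I f u) r / ennreal u * indicator (besov_range s I) u)"
        by (simp add: ennreal_times_divide mult.assoc[symmetric])
    qed
    also have "\<dots> = ennreal_powr (ennreal c) r * besov_integral s p r I f"
      unfolding besov_integral_def by (rule nn_integral_cmult) measurable
    finally have "ennreal_powr (besov_integral s p' r I f) (1 / r)
        \<le> ennreal_powr (ennreal_powr (ennreal c) r * besov_integral s p r I f) (1 / r)"
      using r by (intro ennreal_powr_mono) auto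
    also have "\<dots> = ennreal c * ennreal_powr (besov_integral s p r I f) (1 / r)"
      using r by (simp add: ennreal_powr_mult ennreal_powr_powr_inverse)
    finally show ?thesis
      using False by (simp add: besov_seminorm_finite r_def)
  qed
qed

text \<open>The measure \<open>du / u\<close> is infinite near \<open>0\<close> and near infinity;
  the powers \<alpha> and \<beta> restore convergence at the respective end.\<close>

lemma besov_weight_integral:
  assumes "0 < \<alpha>" "0 < \<beta>"
  shows "(\<integral>\<^sup>+u. ennreal (u powr (if u \<le> 1 then \<alpha> else - \<beta>)) / ennreal u * indicator {0<..} u \<partial>lborel) < top"
proof -
  have A: "((\<lambda>u. u powr (\<alpha> - 1)) has_integral (1 powr (\<alpha> - 1 + 1) / (\<alpha> - 1 + 1))) {0..1}"
    by (rule has_integral_powr_from_0) (use assms in auto)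
  have B: "((\<lambda>u. u powr (- \<beta> - 1)) has_integral - (1 powr (- \<beta> - 1 + 1)) / (- \<beta> - 1 + 1)) {1..}"
    by (rule has_integral_powr_to_inf) (use assms in auto)
  have "(\<integral>\<^sup>+u. ennreal (u powr (if u \<le> 1 then \<alpha> else - \<beta>)) / ennreal u * indicator {0<..} u \<partial>lborel)
      \<le> (\<integral>\<^sup>+u. ennreal (indicator {0..1} u * u powr (\<alpha> - 1)) + ennreal (indicator {1..} u * u powr (- \<beta> - 1)) \<partial>lborel)"
    by (intro nn_integral_mono)
      (auto simp: indicator_def divide_ennreal powr_diff ennreal_plus[symmetric] simp del: ennreal_plus)
  also have "\<dots> = (\<integral>\<^sup>+u. ennreal (indicator {0..1} u * u powr (\<alpha> - 1)) \<partial>lborel)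
      + (\<integral>\<^sup>+u. ennreal (indicator {1..} u * u powr (- \<beta> - 1)) \<partial>lborel)"
    by (intro nn_integral_add) auto
  also have "\<dots> < top"
    using nn_integral_has_integral_lebesgue[OF _ A] nn_integral_has_integral_lebesgue[OF _ B] by simp
  finally show ?thesis .
qed

section \<open>From the Besov norm to decay of the modulus, and back\<close>

context half_open_interval
begin

lemma besov_range_initial:
  assumes "0 < u" "u < l / real (besov_order s)"
  shows "u \<in> besov_range s I"
proof -
  let ?k = "besov_order s"
  have k: "0 < real ?k"
    using besov_order_pos by simp
  have "emeasure lebesgue {a..<a + l} \<le> emeasure lebesgue I"
    by (intro emeasure_mono initial) simp
  then have "ennreal l \<le> emeasure lebesgue I"
    using l_pos by simp
  then have "ennreal l / ennreal (real ?k) \<le> emeasure lebesgue I / of_nat ?k"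
    by (simp add: divide_right_mono_ennreal ennreal_of_nat_eq_real_of_nat)
  moreover have "ennreal u < ennreal l / ennreal (real ?k)"
    using assms l_pos k by (simp add: divide_ennreal ennreal_lessI)
  ultimately show ?thesis
    using assms by (simp add: besov_range_def)
qed

lemma modulus_le_besov_norm:
  assumes "0 < p" "0 < q" "0 < s"
  obtains A where "0 \<le> A"
    "\<And>(f :: real \<Rightarrow> 'x::{banach, second_countable_topology}) u.
      f \<in> borel_measurable (lebesgue_on I) \<Longrightarrow> 0 < u \<Longrightarrow>
      modulus_smoothness (besov_order s) f I u p \<le> ennreal (A * u powr s) * besov_norm s p q I f"
proof -
  let ?k = "besov_order s"
  obtain C where C: "0 \<le> C" "\<And>(f :: real \<Rightarrow> 'x) u. f \<in> borel_measurable (lebesgue_on I) \<Longrightarrow>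
      modulus_smoothness ?k f I u p \<le> ennreal C * lp_qnorm p I f"
    using modulus_le_lp_qnorm[OF assms(1), of ?k] by blast
  \<comment> \<open>Half of the part of the range that is known to exist, so that for
    \<open>u < u0\<close> the whole window from \<open>u\<close> to \<open>2 * u\<close> lies in the
    domain of integration.\<close>
  define u0 where "u0 = l / (2 * real ?k)"
  have u0: "0 < u0"
    using l_pos besov_order_pos by (simp add: u0_def)
  have u0_twice: "l / real ?k = 2 * u0"
    by (simp add: u0_def)
  \<comment> \<open>\<open>2 powr s\<close> is the loss of the weight \<open>v powr - s\<close>
    across the window; \<open>2 powr (1 / q)\<close> compensates for the lower bound
    \<open>1 / 2\<close> for the mass of the window under \<open>dv / v\<close>.\<close>
  define E where "E = (if q = \<infinity> then 1 else 2 powr (s + 1 / enn2real q))"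
  define A where "A = C * u0 powr - s + E"
  have E: "0 \<le> E"
    by (simp add: E_def)
  show ?thesis
  proof (rule that[of A])
    show "0 \<le> A"
      using C E by (simp add: A_def)
    fix f :: "real \<Rightarrow> 'x" and u :: real
    assume f: "f \<in> borel_measurable (lebesgue_on I)" and u: "0 < u"
    show "modulus_smoothness ?k f I u p \<le> ennreal (A * u powr s) * besov_norm s p q I f"
    proof (cases "u0 \<le> u")
      case True
      have "C * 1 \<le> C * (u0 powr - s * u powr s)"
        using u0 C powr_mono2[OF _ _ True, of s] \<open>0 < s\<close>
        by (intro mult_left_mono) (auto simp: powr_minus field_simps)
      also have "\<dots> \<le> A * u powr s"
        using E by (simp add: A_def distrib_right mult.assoc)
      finally have "ennreal C \<le> ennreal (A * u powr s)"
        by (intro ennreal_leI) simp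
      then have "ennreal C * lp_qnorm p I f \<le> ennreal (A * u powr s) * besov_norm s p q I f"
        using lp_qnorm_le_besov_norm by (rule mult_mono) auto
      with C(2)[OF f] show ?thesis
        by (rule order_trans)
    next
      case False
      have range: "v \<in> besov_range s I" if "0 < v" "v < 2 * u" for v
      proof (rule besov_range_initial)
        show "v < l / real ?k"
          using False that u0_twice by linarith
      qed fact
      have "modulus_smoothness ?k f I u p \<le> ennreal (E * u powr s) * besov_seminorm s p q I f"
      proof (cases "q = \<infinity>")
        case True
        have "modulus_smoothness ?k f I u p = ennreal (u powr s) * besov_quotient s p I f u"
          using u by (simp add: besov_quotient_def mult.assoc[symmetric] ennreal_mult[symmetric] powr_minus)
        also have "\<dots> \<le> ennreal (u powr s) * besov_seminorm s p q I f"
          unfolding True besov_seminorm_infinity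
          using range[of u] u by (intro mult_left_mono SUP_upper) auto
        finally show ?thesis
          by (simp add: E_def True)
      next
        case False
        define r where "r = enn2real q"
        have r: "0 < r"
          using enn2real_pos[OF assms(2) False] by (simp add: r_def)
        \<comment> \<open>A lower bound for the quotient on the window: the weight is taken at the
          right end and the modulus at the left end.\<close>
        define W where "W = ennreal ((2 * u) powr - s) * modulus_smoothness ?k f I u p"
        have "ennreal_powr W r / ennreal (2 * u) * emeasure lborel {u<..<2 * u}
            = (\<integral>\<^sup>+v. ennreal_powr W r / ennreal (2 * u) * indicator {u<..<2 * u} v \<partial>lborel)"
          by (subst nn_integral_cmult_indicator) auto
        also have "\<dots> \<le> besov_integral s p r I f"
          unfolding besov_integral_def
        proof (intro nn_integral_mono)
          fix v
          show "ennreal_powr W r / ennreal (2 * u) * indicator {u<..<2 * u} v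
            \<le> ennreal_powr (besov_quotient s p I f v) r / ennreal v * indicator (besov_range s I) v"
          proof (cases "v \<in> {u<..<2 * u}")
            case True
            then have v: "u < v" "v < 2 * u"
              by auto
            have "W \<le> besov_quotient s p I f v"
              unfolding W_def besov_quotient_def using u v \<open>0 < s\<close>
              by (intro mult_mono ennreal_leI powr_mono2' modulus_mono) auto
            moreover have "inverse (ennreal (2 * u)) \<le> inverse (ennreal v)"
              using u v le_imp_inverse_le[of v "2 * u"] by (simp add: inverse_ennreal ennreal_leI del: inverse_mult_distrib)
            ultimately have "ennreal_powr W r / ennreal (2 * u) \<le> ennreal_powr (besov_quotient s p I f v) r / ennreal v"
              using r unfolding divide_ennreal_def by (intro mult_mono ennreal_powr_mono) auto
            then show ?thesis
              using range[of v] u v by simp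
          qed simp
        qed
        also have "emeasure lborel {u<..<2 * u} = ennreal u"
          using u by simp
        also have "ennreal_powr W r / ennreal (2 * u) * ennreal u = ennreal_powr W r * ennreal (1 / 2)"
          using u by (simp add: divide_ennreal_def inverse_ennreal mult.assoc ennreal_mult[symmetric] del: ennreal_half)
        finally have "ennreal_powr (ennreal_powr W r * ennreal (1 / 2)) (1 / r) \<le> besov_seminorm s p q I f"
          using r False by (auto simp: besov_seminorm_finite r_def intro!: ennreal_powr_mono)
        then have "W * ennreal ((1 / 2) powr (1 / r)) \<le> besov_seminorm s p q I f"
          using r by (simp add: ennreal_powr_mult ennreal_powr_powr_inverse ennreal_powr_ennreal del: ennreal_half)
        then have "ennreal (E * u powr s) * (W * ennreal ((1 / 2) powr (1 / r)))
            \<le> ennreal (E * u powr s) * besov_seminorm s p q I f"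
          by (rule mult_left_mono) simp
        moreover have "ennreal (E * u powr s) * (W * ennreal ((1 / 2) powr (1 / r)))
            = ennreal (E * u powr s * (2 * u) powr - s * (1 / 2) powr (1 / r)) * modulus_smoothness ?k f I u p"
          using E by (simp add: W_def ennreal_mult mult_ac)
        moreover have "E * u powr s * (2 * u) powr - s * (1 / 2) powr (1 / r) = 1"
          using u False by (simp add: E_def r_def[symmetric] powr_mult powr_add powr_minus powr_divide field_simps)
        ultimately show ?thesis
          by simp
      qed
      also have "\<dots> \<le> ennreal (A * u powr s) * besov_norm s p q I f"
        using C E by (intro mult_mono ennreal_leI besov_seminorm_le_besov_norm) (auto simp: A_def)
      finally show ?thesis .
    qed
  qed
qed

text \<open>Here \<open>s\<close> is the target smoothness. The assumed decay for
  \<open>u \<le> 1\<close> and the trivial bound for \<open>u > 1\<close> combine into the weight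
  \<open>w\<close>. Its powers are integrable against \<open>du / u\<close>, near \<open>0\<close>
  because \<open>\<sigma> > s\<close> and near infinity because \<open>s > 0\<close>.\<close>

lemma besov_seminorm_le_of_modulus_decay:
  assumes "0 < p" "0 < \<nu>" "0 < s" "s < \<sigma>" "0 \<le> B"
  obtains C where "0 \<le> C"
    "\<And>(f :: real \<Rightarrow> 'x::{banach, second_countable_topology}) M.
      f \<in> borel_measurable (lebesgue_on I) \<Longrightarrow> lp_qnorm p I f \<le> M \<Longrightarrow>
      (\<And>u. 0 < u \<Longrightarrow> modulus_smoothness (besov_order s) f I u p \<le> ennreal (B * u powr \<sigma>) * M) \<Longrightarrow>
      besov_seminorm s p \<nu> I f \<le> ennreal C * M"
proof -
  let ?k = "besov_order s"
  obtain C where C: "0 \<le> C" "\<And>(f :: real \<Rightarrow> 'x) u. f \<in> borel_measurable (lebesgue_on I) \<Longrightarrow>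
      modulus_smoothness ?k f I u p \<le> ennreal C * lp_qnorm p I f"
    using modulus_le_lp_qnorm[OF assms(1), of ?k] by blast
  define D where "D = B + C"
  define w where "w u = u powr (if u \<le> 1 then \<sigma> - s else - s)" for u :: real
  have D: "0 \<le> D" "B \<le> D" "C \<le> D"
    using C assms by (auto simp: D_def)
  have w1: "w u \<le> 1" if "0 < u" for u
    using that assms powr_mono2[of "\<sigma> - s" u 1] powr_mono2'[of "- s" 1 u] by (auto simp: w_def)
  have quotient: "besov_quotient s p I f u \<le> ennreal (w u) * (ennreal D * M)"
    if f: "f \<in> borel_measurable (lebesgue_on I)" "lp_qnorm p I f \<le> M"
      and decay: "\<And>u. 0 < u \<Longrightarrow> modulus_smoothness ?k f I u p \<le> ennreal (B * u powr \<sigma>) * M"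
      and u: "0 < u" for f :: "real \<Rightarrow> 'x" and M u
  proof (cases "u \<le> 1")
    case True
    have "besov_quotient s p I f u \<le> ennreal (u powr - s) * (ennreal (B * u powr \<sigma>) * M)"
      unfolding besov_quotient_def using decay[OF u] by (rule mult_left_mono) simp
    also have "\<dots> = ennreal (w u) * (ennreal B * M)"
      using True u \<open>0 \<le> B\<close>
      by (simp add: w_def powr_diff powr_minus field_simps mult.assoc[symmetric] ennreal_mult[symmetric])
    also have "\<dots> \<le> ennreal (w u) * (ennreal D * M)"
      using D by (intro mult_left_mono mult_right_mono ennreal_leI) auto
    finally show ?thesis .
  next
    case False
    have "besov_quotient s p I f u \<le> ennreal (u powr - s) * (ennreal C * M)"
      unfolding besov_quotient_def
      using order_trans[OF C(2)[OF f(1)] mult_left_mono[OF f(2)]] by (intro mult_left_mono) auto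
    also have "\<dots> \<le> ennreal (w u) * (ennreal D * M)"
      using D False by (intro mult_mono mult_right_mono ennreal_leI) (auto simp: w_def)
    finally show ?thesis .
  qed
  show ?thesis
  proof (cases "\<nu> = \<infinity>")
    case True
    show ?thesis
    proof (rule that[OF D(1)])
      fix f :: "real \<Rightarrow> 'x" and M
      assume f: "f \<in> borel_measurable (lebesgue_on I)" "lp_qnorm p I f \<le> M"
        "\<And>u. 0 < u \<Longrightarrow> modulus_smoothness ?k f I u p \<le> ennreal (B * u powr \<sigma>) * M"
      have "besov_quotient s p I f u \<le> ennreal D * M" if "0 < u" for u
      proof -
        have "ennreal (w u) * (ennreal D * M) \<le> 1 * (ennreal D * M)"
          using w1[OF that] by (intro mult_right_mono) auto
        with quotient[OF f that] show ?thesis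
          by simp
      qed
      then show "besov_seminorm s p \<nu> I f \<le> ennreal D * M"
        unfolding True besov_seminorm_infinity by (intro SUP_least) (simp add: besov_range_def)
    qed
  next
    case False
    define r where "r = enn2real \<nu>"
    have r: "0 < r"
      using enn2real_pos[OF assms(2) False] by (simp add: r_def)
    define J where "J = (\<integral>\<^sup>+u. ennreal (u powr (if u \<le> 1 then (\<sigma> - s) * r else - (s * r))) / ennreal u * indicator {0<..} u \<partial>lborel)"
    have "J < top"
      unfolding J_def using r assms by (intro besov_weight_integral) auto
    then have "ennreal_powr J (1 / r) < top"
      by (rule ennreal_powr_less_top)
    then obtain j where j: "0 \<le> j" "ennreal_powr J (1 / r) = ennreal j"
      by (cases "ennreal_powr J (1 / r)") auto
    show ?thesis
    proof (rule that[of "D * j"])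
      show "0 \<le> D * j"
        using D j by simp
      fix f :: "real \<Rightarrow> 'x" and M
      assume f: "f \<in> borel_measurable (lebesgue_on I)" "lp_qnorm p I f \<le> M"
        "\<And>u. 0 < u \<Longrightarrow> modulus_smoothness ?k f I u p \<le> ennreal (B * u powr \<sigma>) * M"
      have "besov_integral s p r I f \<le> (\<integral>\<^sup>+u. ennreal_powr (ennreal D * M) r *
          (ennreal (u powr (if u \<le> 1 then (\<sigma> - s) * r else - (s * r))) / ennreal u * indicator {0<..} u) \<partial>lborel)"
        unfolding besov_integral_def
      proof (intro nn_integral_mono)
        fix u :: real
        show "ennreal_powr (besov_quotient s p I f u) r / ennreal u * indicator (besov_range s I) u
          \<le> ennreal_powr (ennreal D * M) r *
          (ennreal (u powr (if u \<le> 1 then (\<sigma> - s) * r else - (s * r))) / ennreal u * indicator {0<..} u)"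
        proof (cases "u \<in> besov_range s I")
          case True
          then have u: "0 < u"
            by (simp add: besov_range_def)
          have "ennreal_powr (besov_quotient s p I f u) r \<le> ennreal_powr (ennreal (w u) * (ennreal D * M)) r"
            using r by (intro ennreal_powr_mono quotient[OF f u]) auto
          also have "\<dots> = ennreal_powr (ennreal D * M) r * ennreal (u powr (if u \<le> 1 then (\<sigma> - s) * r else - (s * r)))"
            unfolding ennreal_powr_mult[of "ennreal (w u)"]
            by (subst mult.commute) (simp add: ennreal_powr_ennreal w_def powr_powr)
          finally show ?thesis
            using True u by (simp add: divide_right_mono_ennreal ennreal_times_divide)
        qed simp
      qed
      also have "\<dots> = ennreal_powr (ennreal D * M) r * J"
        unfolding J_def by (rule nn_integral_cmult) measurable
      finally have "ennreal_powr (besov_integral s p r I f) (1 / r)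
          \<le> ennreal_powr (ennreal_powr (ennreal D * M) r * J) (1 / r)"
        using r by (intro ennreal_powr_mono) auto
      also have "\<dots> = ennreal D * M * ennreal j"
        using r by (simp add: ennreal_powr_mult[of "ennreal_powr _ _"] ennreal_powr_powr_inverse j)
      finally show "besov_seminorm s p \<nu> I f \<le> ennreal (D * j) * M"
        using False D j by (simp add: besov_seminorm_finite r_def[symmetric] ennreal_mult mult_ac)
    qed
  qed
qed

lemma besov_embedding_smoothness:
  assumes "0 < p" "0 < q" "0 < t" "t < s" "0 < \<nu>"
  shows "(besov s p q I :: (real \<Rightarrow> 'x::{banach, second_countable_topology}) qnormed) \<hookrightarrow> besov t p \<nu> I"
proof -
  \<comment> \<open>The three bounds on \<sigma> have separate uses: above \<open>t\<close> for
    convergence at \<open>0\<close>, below \<open>s\<close> to inherit the decay, below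
    \<open>besov_order t\<close> for the transfer to that order.\<close>
  have "t < min s (real (besov_order t))"
    using assms besov_order_gt[of t] by simp
  then obtain \<sigma> where \<sigma>: "t < \<sigma>" "\<sigma> < s" "\<sigma> < real (besov_order t)"
    using dense by (metis min_less_iff_conj)
  have "0 < s"
    using assms by simp
  obtain A where A: "0 \<le> A"
    "\<And>(f :: real \<Rightarrow> 'x) u. f \<in> borel_measurable (lebesgue_on I) \<Longrightarrow> 0 < u \<Longrightarrow>
      modulus_smoothness (besov_order s) f I u p \<le> ennreal (A * u powr s) * besov_norm s p q I f"
    using modulus_le_besov_norm[OF assms(1,2) \<open>0 < s\<close>, where 'x = 'x] by blast
  obtain C where C: "0 \<le> C" "\<And>(f :: real \<Rightarrow> 'x) u. f \<in> borel_measurable (lebesgue_on I) \<Longrightarrow>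
      modulus_smoothness (besov_order s) f I u p \<le> ennreal C * lp_qnorm p I f"
    using modulus_le_lp_qnorm[OF assms(1), of "besov_order s", where 'x = 'x] by blast
  have AC: "0 \<le> A + C"
    using A C by simp
  \<comment> \<open>The exponent \<open>s\<close> may exceed \<open>besov_order t\<close>, so the
    transfer is run with \<sigma>. For \<open>u \<le> 1\<close> the power with the smaller exponent
    dominates; for \<open>u > 1\<close> that power is at least \<open>1\<close> and the trivial
    bound suffices.\<close>
  have weaker: "modulus_smoothness (besov_order s) f I u p \<le> ennreal ((A + C) * u powr \<sigma>) * besov_norm s p q I f"
    if f: "f \<in> borel_measurable (lebesgue_on I)" and u: "0 < u" for f :: "real \<Rightarrow> 'x" and u
  proof (cases "u \<le> 1")
    case True
    have "u powr s \<le> u powr \<sigma>"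
      using u True \<sigma> by (intro powr_mono') auto
    then have "A * u powr s \<le> (A + C) * u powr \<sigma>"
      using A C by (intro mult_mono) auto
    then show ?thesis
      using A(2)[OF f u] by (auto intro!: mult_right_mono ennreal_leI elim!: order_trans)
  next
    case False
    have "1 \<le> u powr \<sigma>"
      using False \<sigma> assms by (intro ge_one_powr_ge_zero) auto
    then have "C * 1 \<le> (A + C) * u powr \<sigma>"
      using A C by (intro mult_mono) auto
    then have "ennreal C * lp_qnorm p I f \<le> ennreal ((A + C) * u powr \<sigma>) * besov_norm s p q I f"
      by (intro mult_mono ennreal_leI lp_qnorm_le_besov_norm) auto
    with C(2)[OF f] show ?thesis
      by (rule order_trans)
  qed
  have "0 \<le> \<sigma>"
    using \<sigma> assms by simp
  obtain B where B: "0 \<le> B" and decay: "\<forall>(f :: real \<Rightarrow> 'x) M.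
      f \<in> borel_measurable (lebesgue_on I) \<longrightarrow> lp_qnorm p I f \<le> M \<longrightarrow>
      (\<forall>u>0. modulus_smoothness (besov_order s) f I u p \<le> ennreal ((A + C) * u powr \<sigma>) * M) \<longrightarrow>
      (\<forall>u>0. modulus_smoothness (besov_order t) f I u p \<le> ennreal (B * u powr \<sigma>) * M)"
    using modulus_decay[OF assms(1) besov_order_pos besov_order_mono \<open>0 \<le> \<sigma>\<close> \<sigma>(3) AC, of s, where 'x = 'x]
      assms by auto
  obtain D where D: "0 \<le> D" "\<And>(f :: real \<Rightarrow> 'x) M.
      f \<in> borel_measurable (lebesgue_on I) \<Longrightarrow> lp_qnorm p I f \<le> M \<Longrightarrow>
      (\<And>u. 0 < u \<Longrightarrow> modulus_smoothness (besov_order t) f I u p \<le> ennreal (B * u powr \<sigma>) * M) \<Longrightarrow>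
      besov_seminorm t p \<nu> I f \<le> ennreal D * M"
    using besov_seminorm_le_of_modulus_decay[OF assms(1,5,3) \<sigma>(1) B, where 'x = 'x] by blast
  show ?thesis
  proof (rule besov_embeddingI[OF zero_le_one D(1)])
    fix f :: "real \<Rightarrow> 'x"
    assume f: "f \<in> borel_measurable (lebesgue_on I)"
    show "lp_qnorm p I f \<le> ennreal 1 * besov_norm s p q I f"
      using lp_qnorm_le_besov_norm[of p I f s q] by simp
    have "\<forall>u>0. modulus_smoothness (besov_order t) f I u p \<le> ennreal (B * u powr \<sigma>) * besov_norm s p q I f"
      using decay[rule_format, OF f lp_qnorm_le_besov_norm weaker[OF f]] by blast
    then show "besov_seminorm t p \<nu> I f \<le> ennreal D * besov_norm s p q I f"
      using D(2)[OF f lp_qnorm_le_besov_norm] by blast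
  qed
qed

end

text \<open>Writing the finite exponent as \<open>d + r\<close>, with \<open>r\<close> that of
  \<open>q\<close>, one pulls the \<open>d\<close>-th power of the uniform bound on the quotient out
  of the integral. The factor \<open>A + 1\<close> dominates both the bound \<open>A * M\<close> for
  the quotient and the bound \<open>M\<close> for the seminorm, so the powers \<open>d\<close> and
  \<open>r\<close> recombine.\<close>

lemma besov_seminorm_fine_index:
  assumes "0 < q" "q \<le> \<theta>" "0 \<le> A"
    and "\<And>u. 0 < u \<Longrightarrow> besov_quotient s p I f u \<le> ennreal A * M"
    and "besov_seminorm s p q I f \<le> M"
  shows "besov_seminorm s p \<theta> I f \<le> ennreal (A + 1) * M"
proof (cases "\<theta> = \<infinity>")
  case True
  have "ennreal A * M \<le> ennreal (A + 1) * M"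
    by (intro mult_right_mono ennreal_leI) auto
  then show ?thesis
    unfolding True besov_seminorm_infinity
    using assms(4) by (intro SUP_least) (auto simp: besov_range_def intro: order_trans)
next
  case False
  then have q: "q \<noteq> \<infinity>"
    using \<open>q \<le> \<theta>\<close> by (auto simp: top_unique)
  define r where "r = enn2real q"
  define d where "d = enn2real \<theta> - r"
  have r: "0 < r"
    using enn2real_pos[OF assms(1) q] by (simp add: r_def)
  have d: "0 \<le> d"
    using False \<open>q \<le> \<theta>\<close> by (simp add: d_def r_def enn2real_mono less_top)
  have M: "M \<le> ennreal (A + 1) * M" "ennreal A * M \<le> ennreal (A + 1) * M"
    using \<open>0 \<le> A\<close> mult_right_mono[of 1 "ennreal (A + 1)" M]
    by (auto intro!: mult_right_mono ennreal_leI)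
  have "besov_integral s p (d + r) I f
      \<le> (\<integral>\<^sup>+u. ennreal_powr (ennreal A * M) d *
          (ennreal_powr (besov_quotient s p I f u) r / ennreal u * indicator (besov_range s I) u) \<partial>lborel)"
    unfolding besov_integral_def
  proof (rule nn_integral_mono)
    fix u :: real
    show "ennreal_powr (besov_quotient s p I f u) (d + r) / ennreal u * indicator (besov_range s I) u
      \<le> ennreal_powr (ennreal A * M) d *
          (ennreal_powr (besov_quotient s p I f u) r / ennreal u * indicator (besov_range s I) u)"
    proof (cases "u \<in> besov_range s I")
      case True
      then have "ennreal_powr (besov_quotient s p I f u) d \<le> ennreal_powr (ennreal A * M) d"
        using d assms(4) by (intro ennreal_powr_mono) (auto simp: besov_range_def)
      then have "ennreal_powr (besov_quotient s p I f u) (d + r)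
          \<le> ennreal_powr (ennreal A * M) d * ennreal_powr (besov_quotient s p I f u) r"
        unfolding ennreal_powr_exponent_add by (rule mult_right_mono) simp
      then show ?thesis
        using True by (simp add: divide_right_mono_ennreal ennreal_times_divide)
    qed simp
  qed
  also have "\<dots> = ennreal_powr (ennreal A * M) d * besov_integral s p r I f"
    unfolding besov_integral_def by (rule nn_integral_cmult) measurable
  also have "besov_integral s p r I f = ennreal_powr (besov_seminorm s p q I f) r"
    using r q by (simp add: besov_seminorm_finite r_def[symmetric] ennreal_powr_inverse_powr)
  also have "ennreal_powr (ennreal A * M) d * ennreal_powr (besov_seminorm s p q I f) r
      \<le> ennreal_powr (ennreal (A + 1) * M) d * ennreal_powr (ennreal (A + 1) * M) r"
    using d r
    by (intro mult_mono[OF ennreal_powr_mono[OF _ M(2)] ennreal_powr_mono[OF _ order_trans[OF assms(5) M(1)]]]) auto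
  also have "\<dots> = ennreal_powr (ennreal (A + 1) * M) (d + r)"
    by (simp add: ennreal_powr_exponent_add)
  finally have "ennreal_powr (besov_integral s p (d + r) I f) (1 / (d + r))
      \<le> ennreal_powr (ennreal_powr (ennreal (A + 1) * M) (d + r)) (1 / (d + r))"
    using d r by (intro ennreal_powr_mono) auto
  then show ?thesis
    using False d r by (simp add: besov_seminorm_finite ennreal_powr_powr_inverse) (simp add: d_def)
qed

text \<open>In \<open>V + 1\<close> the measure \<open>V\<close> pays for the points where the
  function is at most \<open>n\<close>, and \<open>1\<close> for those where it is larger. At
  \<open>\<tau> = \<infinity>\<close> the convention \<open>enn2real \<infinity> = 0\<close> and
  division by zero give the exponent \<open>0\<close>, hence the value \<open>1\<close> for
  \<open>V \<ge> 0\<close>.\<close>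

definition finite_measure_const :: "real \<Rightarrow> ennreal \<Rightarrow> real" where
  "finite_measure_const V \<tau> = (V + 1) powr (1 / enn2real \<tau>)"

lemma finite_measure_const_ge_1: "0 \<le> V \<Longrightarrow> 1 \<le> finite_measure_const V \<tau>"
  unfolding finite_measure_const_def by (intro ge_one_powr_ge_zero) auto

text \<open>With \<open>n\<close> the size of \<open>g\<close> in \<open>L\<^sub>p\<close>, the crude bound \<open>(g / n)\<^sup>\<tau> \<le> 1 + (g / n)\<^sup>p\<close> replaces
  Hoelder's inequality, at the price of a constant that is not optimal.\<close>

lemma lp_gauge_finite_measure_aux:
  assumes "0 < \<tau>" "\<tau> \<le> p" "\<tau> \<noteq> \<infinity>" "0 < n" "lp_gauge p g \<le> ennreal n" "0 \<le> V"
    and [measurable]: "S \<in> sets lebesgue" "g \<in> borel_measurable lebesgue"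
    and "emeasure lebesgue S \<le> ennreal V" "\<And>t. t \<notin> S \<Longrightarrow> g t = 0"
  shows "lp_gauge \<tau> g \<le> ennreal (finite_measure_const V \<tau> * n)"
proof -
  define T where "T = enn2real \<tau>"
  have T: "0 < T"
    using enn2real_pos assms by (simp add: T_def)
  have "(\<integral>\<^sup>+t. ennreal_powr (g t) T \<partial>lebesgue) \<le> ennreal (n powr T) * (ennreal V + 1)"
  proof (cases "p = \<infinity>")
    case True
    have "AE t in lebesgue. g t \<le> ennreal n"
      using esssup_AE[of g lebesgue] assms(5) True by (auto simp: lp_gauge_def intro: order_trans)
    then have "AE t in lebesgue. ennreal_powr (g t) T \<le> ennreal (n powr T) * indicator S t"
    proof eventually_elim
      case (elim t)
      then have "ennreal_powr (g t) T \<le> ennreal (n powr T)"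
        using ennreal_powr_mono[OF _ elim, of T] T \<open>0 < n\<close> by (simp add: ennreal_powr_ennreal)
      then show ?case
        using assms(10)[of t] by (cases "t \<in> S") auto
    qed
    then have "(\<integral>\<^sup>+t. ennreal_powr (g t) T \<partial>lebesgue) \<le> (\<integral>\<^sup>+t. ennreal (n powr T) * indicator S t \<partial>lebesgue)"
      by (rule nn_integral_mono_AE)
    also have "\<dots> = ennreal (n powr T) * emeasure lebesgue S"
      by (rule nn_integral_cmult_indicator) measurable
    also have "\<dots> \<le> ennreal (n powr T) * (ennreal V + 1)"
      using assms(9) by (intro mult_left_mono) (auto intro: order_trans)
    finally show ?thesis .
  next
    case False
    define P where "P = enn2real p"
    have "0 < p"
      using assms by (meson less_le_trans)
    then have P: "0 < P" "T \<le> P"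
      using enn2real_pos[OF _ False] assms False by (simp_all add: P_def T_def enn2real_mono less_top)
    have "ennreal_powr (lp_gauge p g) P \<le> ennreal_powr (ennreal n) P"
      using P assms(5) by (intro ennreal_powr_mono) auto
    then have int: "(\<integral>\<^sup>+t. ennreal_powr (g t) P \<partial>lebesgue) \<le> ennreal (n powr P)"
      using False P \<open>0 < n\<close> by (simp add: lp_gauge_def P_def[symmetric] ennreal_powr_inverse_powr ennreal_powr_ennreal)
    have le: "ennreal_powr (g t) T \<le> ennreal (n powr T) * indicator S t + ennreal (n powr (T - P)) * ennreal_powr (g t) P" for t
    proof (cases "g t")
      case (real x)
      show ?thesis
      proof (cases "t \<in> S")
        case False
        then show ?thesis using assms(10) by simp
      next
        case True
        have "x powr T \<le> n powr T + n powr (T - P) * x powr P"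
        proof (cases "x \<le> n")
          case True
          then have "x powr T \<le> n powr T"
            using real T by (intro powr_mono2) auto
          moreover have "0 \<le> n powr (T - P) * x powr P"
            by simp
          ultimately show ?thesis
            by linarith
        next
          case False
          \<comment> \<open>Since \<open>T \<le> P\<close>, the first factor does not increase with
            \<open>x\<close> and is at most its value at \<open>n\<close>.\<close>
          have "x powr T = x powr (T - P) * x powr P"
            by (simp add: powr_add[symmetric])
          also have "\<dots> \<le> n powr (T - P) * x powr P"
            using False P \<open>0 < n\<close> by (intro mult_right_mono powr_mono2') auto
          finally show ?thesis
            by (simp add: add_increasing)
        qed
        then have "ennreal (x powr T) \<le> ennreal (n powr T + n powr (T - P) * x powr P)"
          by (rule ennreal_leI)
        then show ?thesis
          using True real by (simp add: ennreal_powr_ennreal ennreal_mult)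
      qed
    next
      case top
      then show ?thesis
        using \<open>0 < n\<close> by (simp add: ennreal_mult_top)
    qed
    have "(\<integral>\<^sup>+t. ennreal_powr (g t) T \<partial>lebesgue)
        \<le> (\<integral>\<^sup>+t. ennreal (n powr T) * indicator S t + ennreal (n powr (T - P)) * ennreal_powr (g t) P \<partial>lebesgue)"
      by (intro nn_integral_mono le)
    also have "\<dots> = ennreal (n powr T) * emeasure lebesgue S
        + ennreal (n powr (T - P)) * (\<integral>\<^sup>+t. ennreal_powr (g t) P \<partial>lebesgue)"
      by (simp add: nn_integral_add nn_integral_cmult nn_integral_cmult_indicator)
    also have "\<dots> \<le> ennreal (n powr T) * ennreal V + ennreal (n powr (T - P)) * ennreal (n powr P)"
      by (intro add_mono mult_left_mono int assms) auto
    also have "\<dots> = ennreal (n powr T) * (ennreal V + 1)"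
      by (simp add: ennreal_mult[symmetric] powr_add[symmetric] distrib_left)
    finally show ?thesis .
  qed
  then have "lp_gauge \<tau> g \<le> ennreal_powr (ennreal (n powr T) * (ennreal V + 1)) (1 / T)"
    using T assms(3) by (auto simp: lp_gauge_def T_def[symmetric] intro!: ennreal_powr_mono)
  also have "ennreal (n powr T) * (ennreal V + 1) = ennreal (n powr T * (V + 1))"
    using \<open>0 \<le> V\<close> by (simp add: ennreal_mult)
  also have "ennreal_powr (ennreal (n powr T * (V + 1))) (1 / T) = ennreal (finite_measure_const V \<tau> * n)"
    using \<open>0 \<le> V\<close> \<open>0 < n\<close> T
    by (simp add: ennreal_powr_ennreal powr_mult powr_powr finite_measure_const_def T_def[symmetric] mult.commute)
  finally show ?thesis .
qed

text \<open>Normalisation by \<open>n\<close> requires \<open>n > 0\<close>, while the quasi-norm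
  \<open>N\<close> may be zero. The choice \<open>n = N + e / c\<close> leaves an excess of exactly
  \<open>e\<close>, which then tends to zero.\<close>

lemma lp_gauge_finite_measure:
  assumes "0 < \<tau>" "\<tau> \<le> p" "0 \<le> V"
    and "S \<in> sets lebesgue" "g \<in> borel_measurable lebesgue"
    and "emeasure lebesgue S \<le> ennreal V" "\<And>t. t \<notin> S \<Longrightarrow> g t = 0"
  shows "lp_gauge \<tau> g \<le> ennreal (finite_measure_const V \<tau>) * lp_gauge p g"
proof -
  define c where "c = finite_measure_const V \<tau>"
  have c: "1 \<le> c"
    using finite_measure_const_ge_1[OF assms(3)] by (simp add: c_def)
  show ?thesis
  proof (cases "\<tau> = \<infinity>")
    case True
    then have "p = \<tau>"
      using \<open>\<tau> \<le> p\<close> by (simp add: top_unique)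
    then show ?thesis
      using c mult_right_mono[of 1 "ennreal c" "lp_gauge p g"] by (simp add: c_def)
  next
    case False
    show ?thesis
    proof (cases "lp_gauge p g")
      case top
      then show ?thesis
        using c by (simp add: ennreal_mult_top c_def[symmetric])
    next
      case (real N)
      have "lp_gauge \<tau> g \<le> ennreal (c * N)"
      proof (rule ennreal_le_epsilon)
        fix e :: real assume "0 < e"
        have "lp_gauge p g \<le> ennreal (N + e / c)"
          unfolding real using \<open>0 < e\<close> c by (intro ennreal_leI) simp
        then have "lp_gauge \<tau> g \<le> ennreal (c * (N + e / c))"
          unfolding c_def using \<open>0 < e\<close> c real False assms
          by (intro lp_gauge_finite_measure_aux[where p = p and S = S]) (auto simp: c_def intro!: add_nonneg_pos)
        also have "c * (N + e / c) = c * N + e"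
          using c by (simp add: field_simps)
        finally show "lp_gauge \<tau> g \<le> ennreal (c * N) + ennreal e"
          using c real \<open>0 < e\<close> by simp
      qed
      then show ?thesis
        using c real by (simp add: ennreal_mult c_def[symmetric])
    qed
  qed
qed

section \<open>The embeddings in the fine index and in the integrability exponent\<close>

context half_open_interval
begin

lemma besov_embedding_fine_index:
  assumes "0 < p" "0 < q" "0 < s" "q \<le> \<theta>"
  shows "(besov s p q I :: (real \<Rightarrow> 'x::{banach, second_countable_topology}) qnormed) \<hookrightarrow> besov s p \<theta> I"
proof -
  obtain A where A: "0 \<le> A"
    "\<And>(f :: real \<Rightarrow> 'x) u. f \<in> borel_measurable (lebesgue_on I) \<Longrightarrow> 0 < u \<Longrightarrow>
      modulus_smoothness (besov_order s) f I u p \<le> ennreal (A * u powr s) * besov_norm s p q I f"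
    using modulus_le_besov_norm[OF assms(1-3), where 'x = 'x] by blast
  have "0 \<le> A + 1"
    using A by simp
  then show ?thesis
  proof (rule besov_embeddingI[OF zero_le_one])
    fix f :: "real \<Rightarrow> 'x"
    assume f: "f \<in> borel_measurable (lebesgue_on I)"
    show "lp_qnorm p I f \<le> ennreal 1 * besov_norm s p q I f"
      using lp_qnorm_le_besov_norm[of p I f s q] by simp
    have "besov_quotient s p I f u \<le> ennreal A * besov_norm s p q I f" if "0 < u" for u
    proof -
      have "besov_quotient s p I f u \<le> ennreal (u powr - s) * (ennreal (A * u powr s) * besov_norm s p q I f)"
        unfolding besov_quotient_def by (intro mult_left_mono A f that) auto
      also have "\<dots> = ennreal (u powr - s * (A * u powr s)) * besov_norm s p q I f"
        using A by (subst mult.assoc[symmetric], subst ennreal_mult[symmetric]) auto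
      also have "u powr - s * (A * u powr s) = A"
        using that by (simp add: powr_minus field_simps)
      finally show ?thesis .
    qed
    then show "besov_seminorm s p \<theta> I f \<le> ennreal (A + 1) * besov_norm s p q I f"
      using assms A by (intro besov_seminorm_fine_index[where q = q] besov_seminorm_le_besov_norm) auto
  qed
qed

lemma besov_embedding_integrability:
  assumes "bounded I" "0 < q" "0 < \<tau>" "\<tau> \<le> p"
  shows "(besov s p q I :: (real \<Rightarrow> 'x::{banach, second_countable_topology}) qnormed) \<hookrightarrow> besov s \<tau> q I"
proof -
  have "0 < p"
    using assms by (meson less_le_trans)
  have "emeasure lebesgue I < top"
    using bounded_set_imp_lmeasurable[OF \<open>bounded I\<close> I_sets] by (simp add: fmeasurable_def)
  then obtain V where V: "0 \<le> V" "emeasure lebesgue I = ennreal V"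
    by (cases "emeasure lebesgue I") auto
  define c where "c = finite_measure_const V \<tau>"
  have c: "0 \<le> c"
    using finite_measure_const_ge_1[OF V(1), of \<tau>] by (simp add: c_def)
  \<comment> \<open>One constant serves all orders and steps: \<open>diff_dom I d\<close> is
    contained in \<open>I\<close>, so the extended differences all vanish outside
    \<open>I\<close>.\<close>
  have gauge: "lp_gauge \<tau> g \<le> ennreal c * lp_gauge p g"
    if "g \<in> borel_measurable lebesgue" "\<And>t. t \<notin> I \<Longrightarrow> g t = 0" for g
    unfolding c_def using V that by (intro lp_gauge_finite_measure[where S = I] assms I_sets) auto
  show ?thesis
  proof (rule besov_embeddingI[OF c c])
    fix f :: "real \<Rightarrow> 'x"
    assume f: "f \<in> borel_measurable (lebesgue_on I)"
    have "lp_qnorm \<tau> I f \<le> ennreal c * lp_qnorm p I f"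
      unfolding lp_qnorm_eq_lp_gauge(1)[OF \<open>0 < \<tau>\<close> I_sets f] lp_qnorm_eq_lp_gauge(1)[OF \<open>0 < p\<close> I_sets f]
      by (intro gauge lp_qnorm_eq_lp_gauge(2)[OF \<open>0 < p\<close> I_sets f]) auto
    also have "\<dots> \<le> ennreal c * besov_norm s p q I f"
      by (intro mult_left_mono lp_qnorm_le_besov_norm) simp
    finally show "lp_qnorm \<tau> I f \<le> ennreal c * besov_norm s p q I f" .
    have "modulus_smoothness k f I u \<tau> \<le> ennreal c * modulus_smoothness k f I u p" for k u
    proof (rule modulus_smoothness_leI[OF \<open>0 < \<tau>\<close> f])
      fix h assume h: "0 < h" "h \<le> u"
      have "lp_gauge \<tau> (\<lambda>t. ennreal (abs_diff I f k h t)) \<le> ennreal c * lp_gauge p (\<lambda>t. ennreal (abs_diff I f k h t))"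
        using h by (intro gauge abs_diff_eq_lp_gauge(2)[OF \<open>0 < p\<close> f]) (auto simp: abs_diff_def diff_dom_def)
      also have "\<dots> \<le> ennreal c * modulus_smoothness k f I u p"
        by (intro mult_left_mono lp_gauge_abs_diff_le_modulus \<open>0 < p\<close> f h) simp
      finally show "lp_gauge \<tau> (\<lambda>t. ennreal (abs_diff I f k h t)) \<le> ennreal c * modulus_smoothness k f I u p" .
    qed
    then have "besov_seminorm s \<tau> q I f \<le> ennreal c * besov_seminorm s p q I f"
      by (intro besov_seminorm_scale \<open>0 < q\<close> c)
    also have "\<dots> \<le> ennreal c * besov_norm s p q I f"
      by (intro mult_left_mono besov_seminorm_le_besov_norm) simp
    finally show "besov_seminorm s \<tau> q I f \<le> ennreal c * besov_norm s p q I f" .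
  qed
qed

end

theorem proposition7:
  fixes a s :: real and b :: ereal and p q :: ennreal and I :: "real set"
  assumes "ereal a < b" and I: "I = {t. a \<le> t \<and> ereal t < b}"
    and "0 < s" and "0 < p" and "0 < q"
  shows
    "(\<forall>\<epsilon> \<nu> \<theta>. 0 < \<epsilon> \<longrightarrow> \<epsilon> < s \<longrightarrow> 0 < \<nu> \<longrightarrow> q \<le> \<theta> \<longrightarrow>
        (besov s p q I :: (real \<Rightarrow> 'x::{banach, second_countable_topology}) qnormed)
          \<hookrightarrow> besov (s - \<epsilon>) p \<nu> I \<and>
        (besov s p q I :: (real \<Rightarrow> 'x) qnormed) \<hookrightarrow> besov s p \<theta> I) \<and>
     (bounded I \<longrightarrow> (\<forall>\<tau>. 0 < \<tau> \<longrightarrow> \<tau> \<le> p \<longrightarrow>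
        (besov s p q I :: (real \<Rightarrow> 'x) qnormed) \<hookrightarrow> besov s \<tau> q I))"
proof -
  \<comment> \<open>As \<open>b\<close> may be infinite, a real point strictly between
    \<open>a\<close> and \<open>b\<close> provides the initial piece, of length
    \<open>c - a\<close>.\<close>
  obtain c where c: "a < c" "ereal c < b"
    using ereal_dense2[OF assms(1)] by auto
  interpret half_open_interval I a "c - a"
  proof
    show "is_interval I"
      unfolding is_interval_1 I by (auto intro: le_less_trans[of "ereal _" "ereal _"])
    show "{a..<a + (c - a)} \<subseteq> I"
      using c unfolding I by (auto intro: less_trans[of "ereal _" "ereal _"])
  qed (use c I in auto)
  show ?thesis
    using assms(3-5)
    by (auto intro!: besov_embedding_smoothness besov_embedding_fine_index besov_embedding_integrability)
qed

end
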